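(* Fix $c\in(1,\infty)$. Let $(K_i)_{i\ge1}$ be irreducible Markov kernels on a finite set $V$, $c$-stable with respect to a positive probability measure $\mu_0$; set $\mu_n=\mu_0K_{0,n}$. For each $i$ set $\mu_0^i=\mu_0K_i$, let $\sigma_1(K_i,\mu_0^i)$ be the second largest singular value of $K_i:\ell^2(\mu_0^i)\to\ell^2(\mu_0)$, and let $l(K_i^*K_i)$ be the logarithmic Sobolev constant of $K_i^*K_i:\ell^2(\mu_0^i)\to\ell^2(\mu_0^i)$, where $K_i^*$ is the adjoint of $K_i:\ell^2(\mu_0^i)\to\ell^2(\mu_0)$. For $x\in V$ let \[\tilde m_x=\min\Bigl\{t\in\mathbb N:\sum_{i=1}^t\log\bigl(1+c^{-2}l(K_i^*K_i)\bigr)\ge\log\log\bigl(\mu_0(x)^{-1/2}\bigr)\Bigr\}.\] Then for $n\ge\tilde m_x$, \[d_2(K_{0,n}(x,\cdot),\mu_n)^2\le e^2\prod_{i=\tilde m_x+1}^n\Bigl(1-c^{-2}\bigl(1-\sigma_1(K_i,\mu_0^i)^2\bigr)\Bigr).\]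
   Context: $K_{0,n}=K_1\cdots K_n$. $c$-stability w.r.t. $\mu_0$: $c^{-1}\le\mu_n(x)/\mu_0(x)\le c$ for all $n\ge0$, $x\in V$. $K_i^*K_i$ has kernel $\frac{1}{\mu_0^i(x)}\sum_z\mu_0(z)K_i(z,x)K_i(z,y)$, reversible w.r.t. $\mu_0^i$; its second largest eigenvalue is $\sigma_1(K_i,\mu_0^i)^2$. For $P$ reversible w.r.t. $\nu$: $\mathcal E_{P,\nu}(f,f)=\frac12\sum_{x,y}|f(x)-f(y)|^2\nu(x)P(x,y)$, $\mathcal L(f^2,\nu)=\sum_xf^2\log(f^2/\|f\|^2_{\ell^2(\nu)})\nu(x)$, $l(P)=\inf\{\mathcal E_{P,\nu}(f,f)/\mathcal L(f^2,\nu):\mathcal L(f^2,\nu)\ne0,\ f\text{ nonconstant}\}$. $d_2(K_{0,n}(x,\cdot),\mu_n)=(\sum_y|K_{0,n}(x,y)/\mu_n(y)-1|^2\mu_n(y))^{1/2}$. *)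

theory Defs
  imports "HOL-Analysis.Analysis" "HOL-Computational_Algebra.Polynomial" "HOL-Library.Multiset"
begin

definition mmul :: "('v::finite \<Rightarrow> 'v \<Rightarrow> real) \<Rightarrow> ('v \<Rightarrow> 'v \<Rightarrow> real) \<Rightarrow> 'v \<Rightarrow> 'v \<Rightarrow> real" where
  "mmul A B x y = (\<Sum>z\<in>UNIV. A x z * B z y)"

definition vmul :: "('v::finite \<Rightarrow> real) \<Rightarrow> ('v \<Rightarrow> 'v \<Rightarrow> real) \<Rightarrow> 'v \<Rightarrow> real" where
  "vmul \<mu> A y = (\<Sum>z\<in>UNIV. \<mu> z * A z y)"

definition idm :: "'v \<Rightarrow> 'v \<Rightarrow> real" where
  "idm x y = (if x = y then 1 else 0)"

fun mpow :: "('v::finite \<Rightarrow> 'v \<Rightarrow> real) \<Rightarrow> nat \<Rightarrow> 'v \<Rightarrow> 'v \<Rightarrow> real" where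
  "mpow A 0 = idm"
| "mpow A (Suc n) = mmul (mpow A n) A"

fun Kprod :: "(nat \<Rightarrow> 'v::finite \<Rightarrow> 'v \<Rightarrow> real) \<Rightarrow> nat \<Rightarrow> 'v \<Rightarrow> 'v \<Rightarrow> real" where
  "Kprod K 0 = idm"
| "Kprod K (Suc n) = mmul (Kprod K n) (K (Suc n))"

definition markov_kernel :: "('v::finite \<Rightarrow> 'v \<Rightarrow> real) \<Rightarrow> bool" where
  "markov_kernel A \<longleftrightarrow> (\<forall>x y. 0 \<le> A x y) \<and> (\<forall>x. (\<Sum>y\<in>UNIV. A x y) = 1)"

definition irreducible_kernel :: "('v::finite \<Rightarrow> 'v \<Rightarrow> real) \<Rightarrow> bool" where
  "irreducible_kernel A \<longleftrightarrow> (\<forall>x y. \<exists>n. mpow A n x y > 0)"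

definition pos_prob :: "('v::finite \<Rightarrow> real) \<Rightarrow> bool" where
  "pos_prob \<mu> \<longleftrightarrow> (\<forall>x. 0 < \<mu> x) \<and> (\<Sum>x\<in>UNIV. \<mu> x) = 1"

definition mu_n :: "('v::finite \<Rightarrow> real) \<Rightarrow> (nat \<Rightarrow> 'v \<Rightarrow> 'v \<Rightarrow> real) \<Rightarrow> nat \<Rightarrow> 'v \<Rightarrow> real" where
  "mu_n \<mu>0 K n = vmul \<mu>0 (Kprod K n)"

definition c_stable :: "real \<Rightarrow> (nat \<Rightarrow> 'v::finite \<Rightarrow> 'v \<Rightarrow> real) \<Rightarrow> ('v \<Rightarrow> real) \<Rightarrow> bool" where
  "c_stable c K \<mu>0 \<longleftrightarrow> (\<forall>n x. 1 / c \<le> mu_n \<mu>0 K n x / \<mu>0 x \<and> mu_n \<mu>0 K n x / \<mu>0 x \<le> c)"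

text \<open>K^* K for K : l^2(mu_0 K) -> l^2(mu_0); reversible w.r.t. mu_0 K.\<close>
definition adjprod :: "('v::finite \<Rightarrow> 'v \<Rightarrow> real) \<Rightarrow> ('v \<Rightarrow> real) \<Rightarrow> 'v \<Rightarrow> 'v \<Rightarrow> real" where
  "adjprod A \<mu>0 x y = (1 / vmul \<mu>0 A x) * (\<Sum>z\<in>UNIV. \<mu>0 z * A z x * A z y)"

definition charpoly :: "('v::finite \<Rightarrow> 'v \<Rightarrow> real) \<Rightarrow> real poly" where
  "charpoly A = det ((\<chi> i j. (if i = j then [:0, 1:] else 0) - [:A i j:]) :: real poly ^'v^'v)"

definition eigs_desc :: "('v::finite \<Rightarrow> 'v \<Rightarrow> real) \<Rightarrow> real list" where
  "eigs_desc A = rev (sorted_list_of_multiset (proots (charpoly A)))"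

text \<open>Second largest eigenvalue (convention: 0 if there is none, i.e. |V| = 1).\<close>
definition second_eig :: "('v::finite \<Rightarrow> 'v \<Rightarrow> real) \<Rightarrow> real" where
  "second_eig A = (if length (eigs_desc A) \<ge> 2 then eigs_desc A ! 1 else 0)"

text \<open>sigma_1(K, mu_0 K): second largest singular value of K : l^2(mu_0 K) -> l^2(mu_0),
  i.e. square root of the second largest eigenvalue of K^* K.\<close>
definition sigma1 :: "('v::finite \<Rightarrow> 'v \<Rightarrow> real) \<Rightarrow> ('v \<Rightarrow> real) \<Rightarrow> real" where
  "sigma1 A \<mu>0 = sqrt (second_eig (adjprod A \<mu>0))"

definition dirichlet :: "('v::finite \<Rightarrow> 'v \<Rightarrow> real) \<Rightarrow> ('v \<Rightarrow> real) \<Rightarrow> ('v \<Rightarrow> real) \<Rightarrow> real" where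
  "dirichlet P \<nu> f = (1/2) * (\<Sum>x\<in>UNIV. \<Sum>y\<in>UNIV. (f x - f y)^2 * \<nu> x * P x y)"

definition l2norm_sq :: "('v::finite \<Rightarrow> real) \<Rightarrow> ('v \<Rightarrow> real) \<Rightarrow> real" where
  "l2norm_sq f \<nu> = (\<Sum>x\<in>UNIV. (f x)^2 * \<nu> x)"

text \<open>L(f^2, nu); note ln 0 = 0 in Isabelle, matching the convention 0 log 0 = 0.\<close>
definition entropy_L :: "('v::finite \<Rightarrow> real) \<Rightarrow> ('v \<Rightarrow> real) \<Rightarrow> real" where
  "entropy_L f \<nu> = (\<Sum>x\<in>UNIV. (f x)^2 * ln ((f x)^2 / l2norm_sq f \<nu>) * \<nu> x)"

definition logsob :: "('v::finite \<Rightarrow> 'v \<Rightarrow> real) \<Rightarrow> ('v \<Rightarrow> real) \<Rightarrow> real" where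
  "logsob P \<nu> = Inf {dirichlet P \<nu> f / entropy_L f \<nu> | f.
      entropy_L f \<nu> \<noteq> 0 \<and> (\<exists>x y. f x \<noteq> f y)}"

definition d2_sq :: "(nat \<Rightarrow> 'v::finite \<Rightarrow> 'v \<Rightarrow> real) \<Rightarrow> ('v \<Rightarrow> real) \<Rightarrow> nat \<Rightarrow> 'v \<Rightarrow> real" where
  "d2_sq K \<mu>0 n x = (\<Sum>y\<in>UNIV. \<bar>Kprod K n x y / mu_n \<mu>0 K n y - 1\<bar>^2 * mu_n \<mu>0 K n y)"

definition mt_cond :: "real \<Rightarrow> (nat \<Rightarrow> 'v::finite \<Rightarrow> 'v \<Rightarrow> real) \<Rightarrow> ('v \<Rightarrow> real) \<Rightarrow> 'v \<Rightarrow> nat \<Rightarrow> bool" where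
  "mt_cond c K \<mu>0 x t \<longleftrightarrow>
     (\<Sum>i=1..t. ln (1 + c powr (-2) * logsob (adjprod (K i) \<mu>0) (vmul \<mu>0 (K i))))
       \<ge> ln (ln (\<mu>0 x powr (-1/2)))"

definition mtilde :: "real \<Rightarrow> (nat \<Rightarrow> 'v::finite \<Rightarrow> 'v \<Rightarrow> real) \<Rightarrow> ('v \<Rightarrow> real) \<Rightarrow> 'v \<Rightarrow> nat" where
  "mtilde c K \<mu>0 x = (LEAST t. mt_cond c K \<mu>0 x t)"

end

theory Submission
  imports Defs
begin

text \<open>A measure comparison turns the logarithmic Sobolev inequality and the spectral gap of
  \<open>K\<^sub>i\<^sup>*K\<^sub>i\<close> relative to \<open>\<mu>\<^sub>0K\<^sub>i\<close> into those relative to \<open>\<mu>\<^sub>i = \<mu>\<^sub>i\<^sub>-\<^sub>1K\<^sub>i\<close>, with the loss \<open>c\<^sup>-\<^sup>2\<close>: the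
  Dirichlet form is linear in the base measure, while entropy and variance are minima of
  integrals of nonnegative functions. If \<open>l\<close> is a logarithmic Sobolev constant for one step, the step
  maps \<open>\<ell>\<^sup>r\<close> to \<open>\<ell>\<^sup>r\<^sup>(\<^sup>1\<^sup>+\<^sup>l\<^sup>)\<close> with norm at most 1, so after \<open>m\<close> steps
  \<open>\<ell>\<^sup>2(\<mu>\<^sub>m)\<close> is mapped to \<open>\<ell>\<^sup>q(\<mu>\<^sub>0)\<close> with \<open>q = 2 \<Prod>(1 + l\<^sub>i)\<close>. Once \<open>q \<ge> log (1/\<mu>\<^sub>0(x))\<close>, the density of
  \<open>K\<^sub>0\<^sub>,\<^sub>m(x, \<cdot>)\<close> has \<open>\<ell>\<^sup>2\<close> norm at most \<open>e\<close>; the remaining steps contract the variance.\<close>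

subsection \<open>The second eigenvalue\<close>

text \<open>The Leibniz formula uses ring operations only. Two homomorphisms matter below:
  evaluation of polynomials at a point, and the embedding of constants into polynomials.\<close>

lemma det_ring_hom:
  fixes h :: "'a::comm_ring_1 \<Rightarrow> 'b::comm_ring_1" and A :: "'a ^ 'n ^ 'n"
  assumes add: "\<And>a b. h (a + b) = h a + h b"
    and mult: "\<And>a b. h (a * b) = h a * h b" and one: "h 1 = 1"
  shows "h (det A) = det (\<chi> i j. h (A $ i $ j))"
proof -
  have zero: "h 0 = 0"
    using add[of 0 0] by simp
  have neg: "h (- 1) = - 1"
    using add[of 1 "- 1"] zero one by (simp add: eq_neg_iff_add_eq_0 add.commute)
  have sum: "h (sum g S) = (\<Sum>i\<in>S. h (g i))" for g and S :: "('n \<Rightarrow> 'n) set"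
    by (induction S rule: infinite_finite_induct) (simp_all add: add zero)
  have prod: "h (prod g S) = (\<Prod>i\<in>S. h (g i))" for g and S :: "'n set"
    by (induction S rule: infinite_finite_induct) (simp_all add: mult one)
  have sgn: "h (of_int (sign p)) = of_int (sign p)" for p :: "'n \<Rightarrow> 'n"
    by (simp add: sign_def one neg)
  show ?thesis
    unfolding det_def by (simp add: sum mult prod sgn)
qed

text \<open>Each term of the Leibniz expansion contains exactly one entry of row j and one of row k,
  and these are different factors.\<close>

lemma mult_dvd_det_two_rows:
  fixes A :: "'a::comm_ring_1 ^ 'n ^ 'n"
  assumes "j \<noteq> k" and "\<And>i. d dvd A $ j $ i" and "\<And>i. e dvd A $ k $ i"
  shows "d * e dvd det A"
  unfolding det_def
proof (intro dvd_sum dvd_mult)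
  fix p :: "'n \<Rightarrow> 'n"
  have "(\<Prod>i\<in>UNIV. A $ i $ p i) = A $ j $ p j * (A $ k $ p k * (\<Prod>i\<in>UNIV - {j} - {k}. A $ i $ p i))"
    using \<open>j \<noteq> k\<close> by (simp add: prod.remove[of UNIV j] prod.remove[of "UNIV - {j}" k])
  also have "d * e dvd \<dots>"
    using assms(2)[of "p j"] assms(3)[of "p k"] by (metis dvd_mult2 mult.assoc mult_dvd_mono)
  finally show "d * e dvd (\<Prod>i\<in>UNIV. A $ i $ p i)" .
qed

lemma poly_charpoly:
  "poly (charpoly A) t = det (\<chi> i j. (if i = j then t else 0) - A i j)"
proof -
  have "poly (charpoly A) t =
      det (\<chi> i j. poly (((\<chi> i j. (if i = j then [:0, 1:] else 0) - [:A i j:]) :: real poly ^'a^'a) $ i $ j) t)"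
    unfolding charpoly_def by (rule det_ring_hom) auto
  also have "\<dots> = det (\<chi> i j. (if i = j then t else 0) - A i j)"
    by (intro arg_cong[of _ _ det]) (simp add: vec_eq_iff)
  finally show ?thesis .
qed

text \<open>Makes \<open>proots\<close> meaningful, which is empty for the zero polynomial. The
  value at 2 is nonzero: averaging by a Markov kernel does not increase the maximum of
  \<bar>v\<bar>, so 2 is no eigenvalue.\<close>

lemma charpoly_neq_0:
  assumes "markov_kernel A"
  shows "charpoly A \<noteq> 0"
proof
  assume "charpoly A = 0"
  let ?M = "(\<chi> i j. (if i = j then 2 else 0) - A i j) :: real^'a^'a"
  from \<open>charpoly A = 0\<close> have "det ?M = 0"
    using poly_charpoly[of A 2] by simp
  then have "\<not> invertible ?M"
    by (simp add: invertible_det_nz)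
  then obtain v where v: "?M *v v = 0" "v \<noteq> 0"
    by (meson invertible_left_inverse matrix_left_invertible_ker)
  have eig: "2 * v $ i = (\<Sum>j\<in>UNIV. A i j * v $ j)" for i
  proof -
    have "0 = (?M *v v) $ i"
      using v by simp
    also have "\<dots> = (\<Sum>j\<in>UNIV. (if i = j then 2 * v $ j else 0) - A i j * v $ j)"
      by (auto simp: matrix_vector_mult_def algebra_simps intro!: sum.cong)
    finally show ?thesis
      by (simp add: sum_subtractf)
  qed
  define m where "m = Max (range (\<lambda>i. \<bar>v $ i\<bar>))"
  have le: "\<bar>v $ i\<bar> \<le> m" for i
    unfolding m_def by (rule Max_ge) auto
  have "m \<in> range (\<lambda>i. \<bar>v $ i\<bar>)"
    unfolding m_def by (rule Max_in) auto
  then obtain i where i: "m = \<bar>v $ i\<bar>"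
    by auto
  have "2 * m \<le> (\<Sum>j\<in>UNIV. \<bar>A i j * v $ j\<bar>)"
    using i eig[of i] sum_abs[of "\<lambda>j. A i j * v $ j" UNIV] by linarith
  also have "\<dots> \<le> (\<Sum>j\<in>UNIV. A i j * m)"
    using assms le by (intro sum_mono) (auto simp: abs_mult markov_kernel_def intro!: mult_left_mono)
  also have "\<dots> = m"
    using assms by (simp add: sum_distrib_right[symmetric] markov_kernel_def)
  finally have "m \<le> 0"
    by simp
  then have "v $ j = 0" for j
    using le[of j] by simp
  then show False
    using v by (simp add: vec_eq_iff)
qed

text \<open>Right multiplication by \<open>Q\<close>, the identity matrix with columns \<open>j\<close> and \<open>k\<close> replaced by the
  eigenvectors \<open>1\<close> and \<open>f\<close>, extracts the two factors also when \<open>\<rho> = 1\<close> is a double root.\<close>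

lemma linear_factors_dvd_charpoly:
  fixes A :: "'v::finite \<Rightarrow> 'v \<Rightarrow> real"
  assumes "\<And>x. (\<Sum>y\<in>UNIV. A x y) = 1" and "\<And>x. (\<Sum>y\<in>UNIV. A x y * f y) = \<rho> * f x"
    and "f j \<noteq> f k"
  shows "[:- 1, 1:] * [:- \<rho>, 1:] dvd charpoly A"
proof -
  have "j \<noteq> k"
    using assms(3) by auto
  define M :: "real poly ^'v^'v" where "M = (\<chi> i j. (if i = j then [:0, 1:] else 0) - [:A i j:])"
  define R :: "real ^'v^'v" where
    "R = (\<chi> i l. if l = j then 1 else if l = k then f i else if i = l then 1 else 0)"
  define Q :: "real poly ^'v^'v" where "Q = (\<chi> i l. [:R $ i $ l:])"
  have "det R \<noteq> 0"
  proof -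
    have "v = 0" if v: "R *v v = 0" for v
    proof -
      have row: "v $ j + f i * v $ k + (if i = j \<or> i = k then 0 else v $ i) = 0" for i
      proof -
        have "0 = (\<Sum>l\<in>UNIV. R $ i $ l * v $ l)"
          using v by (simp add: matrix_vector_mult_def vec_eq_iff)
        also have "\<dots> = v $ j + (f i * v $ k + (\<Sum>l\<in>UNIV - {j} - {k}. R $ i $ l * v $ l))"
          using \<open>j \<noteq> k\<close>
          by (simp add: sum.remove[of UNIV j] sum.remove[of "UNIV - {j}" k] R_def)
        also have "(\<Sum>l\<in>UNIV - {j} - {k}. R $ i $ l * v $ l) =
            (\<Sum>l\<in>UNIV - {j} - {k}. if i = l then v $ l else 0)"
          by (intro sum.cong) (auto simp: R_def)
        finally show ?thesis
          by (auto split: if_splits)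
      qed
      have "v $ j + f j * v $ k = 0" and "v $ j + f k * v $ k = 0"
        using row[of j] row[of k] by simp_all
      then have "f j * v $ k = f k * v $ k"
        by linarith
      then have vk: "v $ k = 0"
        using assms(3) by simp
      then have "v $ j = 0"
        using row[of j] by simp
      with vk have "v $ i = 0" for i
        using row[of i] by (auto split: if_splits)
      then show "v = 0"
        by (simp add: vec_eq_iff)
    qed
    then show ?thesis
      by (metis invertible_det_nz invertible_left_inverse matrix_left_invertible_ker)
  qed
  have detQ: "det Q = [:det R:]"
    unfolding Q_def by (rule det_ring_hom[symmetric]) (auto simp: one_pCons)
  have col: "(M ** Q) $ i $ l = [:0, 1:] * [:R $ i $ l:] - (\<Sum>m\<in>UNIV. [:A i m * R $ m $ l:])" for i l
  proof -
    have "(M ** Q) $ i $ l = (\<Sum>m\<in>UNIV. (if i = m then [:0, 1:] * [:R $ m $ l:] else 0) - [:A i m * R $ m $ l:])"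
      by (auto simp: matrix_matrix_mult_def M_def Q_def algebra_simps intro!: sum.cong)
    then show ?thesis
      by (simp add: sum_subtractf)
  qed
  have const: "(\<Sum>m\<in>UNIV. [:g m:]) = [:\<Sum>m\<in>UNIV. g m:]" for g :: "'v \<Rightarrow> real"
    by (simp add: poly_eq_iff coeff_sum coeff_pCons split: nat.splits)
  have "(M ** Q) $ i $ j = [:- 1, 1:]" for i
    unfolding col const by (simp add: R_def assms(1))
  moreover have "(M ** Q) $ i $ k = [:- \<rho>, 1:] * [:f i:]" for i
    unfolding col const using \<open>j \<noteq> k\<close> by (simp add: R_def assms(2))
  \<comment> \<open>The factors sit in columns j and k, while the divisibility lemma speaks of rows;
    hence the transpose.\<close>
  ultimately have "[:- 1, 1:] * [:- \<rho>, 1:] dvd det (transpose (M ** Q))"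
    using \<open>j \<noteq> k\<close> by (intro mult_dvd_det_two_rows[of j k]) (simp_all add: transpose_def del: mult_pCons_left mult_pCons_right)
  also have "det (transpose (M ** Q)) = smult (det R) (charpoly A)"
    by (simp add: det_transpose det_mul detQ charpoly_def M_def)
  finally show ?thesis
    using \<open>det R \<noteq> 0\<close> by (simp add: dvd_smult_iff del: mult_pCons_left mult_pCons_right)
qed

text \<open>Counting argument: with multiplicity, at least two roots are \<ge> \<rho>, namely 1 and
  \<rho>, even when \<rho> = 1. If the second entry of the descending list were below \<rho>, only
  its head could be \<ge> \<rho>.\<close>

lemma second_eig_ge:
  assumes "markov_kernel A" and "[:- 1, 1:] * [:- \<rho>, 1:] dvd charpoly A" and "\<rho> \<le> 1"
  shows "\<rho> \<le> second_eig A"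
proof -
  obtain q where q: "charpoly A = [:- 1, 1:] * [:- \<rho>, 1:] * q"
    using assms(2) by auto
  have "charpoly A \<noteq> 0"
    using assms(1) by (rule charpoly_neq_0)
  then have "q \<noteq> 0" and "[:- 1, 1:] * [:- \<rho>, 1:] \<noteq> 0"
    using q by auto
  then have pr: "proots (charpoly A) = {#1, \<rho>#} + proots q"
    unfolding q by (subst proots_mult, simp, simp, subst proots_mult) simp_all
  define L where "L = eigs_desc A"
  have mL: "mset L = {#1, \<rho>#} + proots q"
    unfolding L_def eigs_desc_def by (simp add: pr)
  have sL: "sorted (rev L)"
    unfolding L_def eigs_desc_def by simp
  have len: "2 \<le> length L"
    using arg_cong[OF mL, of size] by simp
  then obtain a b R where L: "L = a # b # R"
    by (cases L; cases "tl L") auto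
  have desc: "\<forall>y\<in>set R. y \<le> b"
    using sL unfolding L by (auto simp: sorted_append)
  have "\<rho> \<le> b"
  proof (rule ccontr)
    assume "\<not> \<rho> \<le> b"
    then have "filter_mset (\<lambda>y. \<rho> \<le> y) (mset (b # R)) = {#}"
      using desc by (fastforce simp: filter_mset_eq_conv)
    then have "size (filter_mset (\<lambda>y. \<rho> \<le> y) (mset L)) \<le> 1"
      unfolding L by simp
    then show False
      unfolding mL using \<open>\<rho> \<le> 1\<close> by simp
  qed
  then show ?thesis
    using len unfolding second_eig_def L_def[symmetric] L by simp
qed

section \<open>Variance, Dirichlet form and spectral gap\<close>

definition mean :: "('v::finite \<Rightarrow> real) \<Rightarrow> ('v \<Rightarrow> real) \<Rightarrow> real" where
  "mean f \<nu> = (\<Sum>x\<in>UNIV. f x * \<nu> x)"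

lemma dirichlet_shift: "dirichlet P \<nu> (\<lambda>x. f x - a) = dirichlet P \<nu> f"
  by (simp add: dirichlet_def)

lemma dirichlet_scale: "dirichlet P \<nu> (\<lambda>x. a * f x) = a\<^sup>2 * dirichlet P \<nu> f"
  by (simp add: dirichlet_def right_diff_distrib[symmetric] power_mult_distrib sum_distrib_left
      mult.assoc mult.left_commute)

lemma l2norm_sq_scale: "l2norm_sq (\<lambda>x. a * f x) \<nu> = a\<^sup>2 * l2norm_sq f \<nu>"
  by (simp add: l2norm_sq_def power_mult_distrib sum_distrib_left mult.assoc)

lemma l2norm_sq_shift:
  assumes "pos_prob \<nu>"
  shows "l2norm_sq (\<lambda>x. g x - a) \<nu> = l2norm_sq g \<nu> - 2 * a * mean g \<nu> + a\<^sup>2"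
proof -
  have "(g x - a)\<^sup>2 * \<nu> x = (g x)\<^sup>2 * \<nu> x - 2 * a * (g x * \<nu> x) + a\<^sup>2 * \<nu> x" for x
    by (simp add: power2_eq_square algebra_simps)
  then show ?thesis
    using assms
    by (simp add: l2norm_sq_def mean_def sum.distrib sum_subtractf sum_distrib_left[symmetric] pos_prob_def)
qed

text \<open>Expansion of the quadratic form in the direction of a point indicator. Reversibility
  makes the two halves of the cross term equal, so the linear coefficient is a multiple of (I - P) f
  at z; this yields the Euler-Lagrange equation of a minimizer.\<close>

lemma dirichlet_perturb_indicator:
  fixes P :: "'v::finite \<Rightarrow> 'v \<Rightarrow> real"
  assumes rev: "\<And>x y. \<nu> x * P x y = \<nu> y * P y x" and one: "\<And>x. (\<Sum>y\<in>UNIV. P x y) = 1"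
  shows "dirichlet P \<nu> (\<lambda>x. f x + t * of_bool (x = z)) =
    dirichlet P \<nu> f + 2 * t * (\<nu> z * (f z - (\<Sum>y\<in>UNIV. P z y * f y)))
      + t\<^sup>2 * dirichlet P \<nu> (\<lambda>x. of_bool (x = z))"
proof -
  let ?e = "\<lambda>x. of_bool (x = z) :: real"
  let ?B = "\<Sum>x\<in>UNIV. \<Sum>y\<in>UNIV. (f x - f y) * (?e x - ?e y) * (\<nu> x * P x y)"
  have "dirichlet P \<nu> (\<lambda>x. f x + t * ?e x) =
      1/2 * (\<Sum>x\<in>UNIV. \<Sum>y\<in>UNIV. (f x - f y)\<^sup>2 * \<nu> x * P x y
        + (2 * t) * ((f x - f y) * (?e x - ?e y) * (\<nu> x * P x y))
        + t\<^sup>2 * ((?e x - ?e y)\<^sup>2 * \<nu> x * P x y))"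
    unfolding dirichlet_def
    by (intro arg_cong[where f = "(*) (1/2)"] sum.cong) (auto simp: power2_eq_square algebra_simps)
  also have "\<dots> = dirichlet P \<nu> f + t * ?B + t\<^sup>2 * dirichlet P \<nu> ?e"
    unfolding dirichlet_def sum.distrib sum_distrib_left[symmetric] by (simp add: algebra_simps)
  also have "?B = (\<Sum>x\<in>UNIV. ?e x * (\<Sum>y\<in>UNIV. (f x - f y) * (\<nu> x * P x y)))
      - (\<Sum>y\<in>UNIV. ?e y * (\<Sum>x\<in>UNIV. (f x - f y) * (\<nu> x * P x y)))"
    unfolding sum_distrib_left
    by (subst (3) sum.swap) (simp add: sum_subtractf[symmetric] algebra_simps)
  also have "\<dots> = (\<Sum>y\<in>UNIV. (f z - f y) * (\<nu> z * P z y)) - (\<Sum>x\<in>UNIV. (f x - f z) * (\<nu> x * P x z))"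
    by (simp add: of_bool_def if_distrib[of "\<lambda>a. a * _"] cong: if_cong)
  also have "(\<Sum>x\<in>UNIV. (f x - f z) * (\<nu> x * P x z)) = - (\<Sum>y\<in>UNIV. (f z - f y) * (\<nu> z * P z y))"
    by (simp add: rev[of _ z] sum_negf[symmetric] algebra_simps)
  also have "(\<Sum>y\<in>UNIV. (f z - f y) * (\<nu> z * P z y)) = \<nu> z * (f z * (\<Sum>y\<in>UNIV. P z y) - (\<Sum>y\<in>UNIV. P z y * f y))"
    by (simp add: sum_distrib_left right_diff_distrib sum_subtractf algebra_simps)
  finally show ?thesis
    by (simp add: one algebra_simps)
qed

lemma nonneg_quadratic_linear_coeff:
  fixes a b :: real
  assumes "\<And>t. 0 \<le> 2 * t * b + t\<^sup>2 * a"
  shows "b = 0"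
proof -
  \<comment> \<open>\<open>s\<close> is a positive upper bound of \<open>a\<close>, so t = -b/s is
    defined whatever the sign of \<open>a\<close>, and the quadratic is at most -b^2/s
    there.\<close>
  define s where "s = \<bar>a\<bar> + 1"
  have s: "0 < s" "a \<le> s"
    unfolding s_def by auto
  have "0 \<le> 2 * (- b / s) * b + (- b / s)\<^sup>2 * a"
    by (rule assms)
  also have "\<dots> \<le> 2 * (- b / s) * b + (- b / s)\<^sup>2 * s"
    using s by (intro add_left_mono mult_left_mono) auto
  also have "\<dots> = - (b\<^sup>2 / s)"
    using s by (simp add: power2_eq_square field_simps)
  finally show ?thesis
    using s by (auto simp: divide_le_0_iff)
qed

text \<open>Rayleigh quotient: f minimizes the Dirichlet form over the compact set of functions with
  mean 0 and norm 1, and \<rho> is 1 minus the minimum. The Euler-Lagrange equation is the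
  eigenvalue equation. The two distinct points make the set nonempty.\<close>

lemma exists_second_eigenvector:
  fixes P :: "'v::finite \<Rightarrow> 'v \<Rightarrow> real"
  assumes rev: "\<And>x y. \<nu> x * P x y = \<nu> y * P y x" and P: "markov_kernel P"
    and \<nu>: "pos_prob \<nu>" and "u \<noteq> (w :: 'v)"
  obtains \<rho> f j k where "\<And>x. (\<Sum>y\<in>UNIV. P x y * f y) = \<rho> * f x" and "f j \<noteq> f k" and "\<rho> \<le> 1"
    and "\<And>g. (1 - \<rho>) * (l2norm_sq g \<nu> - (mean g \<nu>)\<^sup>2) \<le> dirichlet P \<nu> g"
proof -
  have one: "\<And>x. (\<Sum>y\<in>UNIV. P x y) = 1" and Pn: "\<And>x y. 0 \<le> P x y"
    using P by (auto simp: markov_kernel_def)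
  have \<nu>0: "0 < \<nu> x" and \<nu>1: "sum \<nu> UNIV = 1" for x
    using \<nu> by (auto simp: pos_prob_def)
  have l2_pos: "0 < l2norm_sq g \<nu>" if "g x \<noteq> 0" for g x
    unfolding l2norm_sq_def using that \<nu>0 by (intro sum_pos2[of _ x]) (auto simp: less_imp_le)
  define S where "S = {v :: real^'v. l2norm_sq (($) v) \<nu> = 1 \<and> mean (($) v) \<nu> = 0}"
  have vec_nth_vec_lambda: "($) (vec_lambda h) = h" for h :: "'v \<Rightarrow> real"
    by auto
  have "closed S"
    unfolding S_def l2norm_sq_def mean_def
    by (intro closed_Collect_conj closed_Collect_eq continuous_intros)
  moreover have "bounded S"
  proof -
    have "norm v \<le> (\<Sum>x\<in>UNIV. 1 / \<nu> x + 1)" if "v \<in> S" for v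
    proof -
      have "\<bar>v $ x\<bar> \<le> 1 / \<nu> x + 1" for x
      proof -
        have "(v $ x)\<^sup>2 * \<nu> x \<le> l2norm_sq (($) v) \<nu>"
          unfolding l2norm_sq_def using \<nu>0 by (intro member_le_sum) (auto simp: less_imp_le)
        then have "(v $ x)\<^sup>2 \<le> 1 / \<nu> x"
          using that \<nu>0[of x] by (simp add: S_def field_simps)
        moreover have "\<bar>v $ x\<bar> \<le> (v $ x)\<^sup>2 + 1"
          using zero_le_power2[of "\<bar>v $ x\<bar> - 1"] by (simp add: power2_diff)
        ultimately show ?thesis
          by linarith
      qed
      then show ?thesis
        using norm_le_l1_cart[of v] by (meson order_trans sum_mono)
    qed
    then show ?thesis
      by (auto simp: bounded_iff)
  qed
  ultimately have "compact S"
    by (simp add: compact_eq_bounded_closed)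
  moreover have "S \<noteq> {}"
  proof -
    \<comment> \<open>The weights 1/\<nu> make the two point contributions cancel in the mean;
      \<open>a\<close> then normalizes.\<close>
    define g where "g = (\<lambda>x. of_bool (x = u) / \<nu> u - of_bool (x = w) / \<nu> w)"
    define a where "a = 1 / sqrt (l2norm_sq g \<nu>)"
    have "mean g \<nu> = 0"
      unfolding mean_def g_def using \<nu>0[of u] \<nu>0[of w]
      by (simp add: of_bool_def left_diff_distrib sum_subtractf if_distrib[of "\<lambda>a. a * _"]
          if_distrib[of "\<lambda>a. a / _"] cong: if_cong)
    then have "mean (\<lambda>x. a * g x) \<nu> = 0"
      by (simp add: mean_def sum_distrib_left[symmetric] mult.assoc)
    moreover have "g u \<noteq> 0"
      using \<open>u \<noteq> w\<close> \<nu>0[of u] by (simp add: g_def)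
    then have "0 < l2norm_sq g \<nu>"
      by (rule l2_pos)
    then have "l2norm_sq (\<lambda>x. a * g x) \<nu> = 1"
      unfolding l2norm_sq_scale by (simp add: a_def power_divide)
    ultimately have "(\<chi> x. a * g x) \<in> S"
      by (simp add: S_def vec_nth_vec_lambda)
    then show ?thesis
      by auto
  qed
  moreover have "continuous_on S (\<lambda>v. dirichlet P \<nu> (($) v))"
    unfolding dirichlet_def by (intro continuous_intros)
  ultimately obtain v where v: "v \<in> S" and min: "\<And>w. w \<in> S \<Longrightarrow> dirichlet P \<nu> (($) v) \<le> dirichlet P \<nu> (($) w)"
    by (metis continuous_attains_inf)
  define f where "f = ($) v"
  define \<delta> where "\<delta> = dirichlet P \<nu> f"
  have f: "l2norm_sq f \<nu> = 1" "mean f \<nu> = 0"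
    using v by (auto simp: S_def f_def)
  have var: "l2norm_sq (\<lambda>x. g x - mean g \<nu>) \<nu> = l2norm_sq g \<nu> - (mean g \<nu>)\<^sup>2" for g
    by (simp add: l2norm_sq_shift[OF \<nu>] power2_eq_square)
  \<comment> \<open>Subtracting the mean leaves the Dirichlet form unchanged and scaling multiplies
    both sides alike, so minimality on \<open>S\<close> extends to every \<open>g\<close>.\<close>
  have gap: "\<delta> * (l2norm_sq g \<nu> - (mean g \<nu>)\<^sup>2) \<le> dirichlet P \<nu> g" for g
  proof -
    define h where "h = (\<lambda>x. g x - mean g \<nu>)"
    have mh: "mean h \<nu> = 0"
      by (simp add: mean_def h_def left_diff_distrib sum_subtractf sum_distrib_left[symmetric] \<nu>1)
    have dh: "dirichlet P \<nu> h = dirichlet P \<nu> g"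
      unfolding h_def by (rule dirichlet_shift)
    have "\<delta> * l2norm_sq h \<nu> \<le> dirichlet P \<nu> h"
    proof (cases "\<exists>x. h x \<noteq> 0")
      case True
      then have pos: "0 < l2norm_sq h \<nu>"
        using l2_pos by auto
      define a where "a = 1 / sqrt (l2norm_sq h \<nu>)"
      have a: "a\<^sup>2 = 1 / l2norm_sq h \<nu>"
        using pos by (simp add: a_def power_divide)
      have "mean (\<lambda>x. a * h x) \<nu> = 0"
        using mh by (simp add: mean_def sum_distrib_left[symmetric] mult.assoc)
      then have "(\<chi> x. a * h x) \<in> S"
        using pos by (simp add: S_def vec_nth_vec_lambda l2norm_sq_scale a)
      from min[OF this] have "\<delta> \<le> dirichlet P \<nu> (\<lambda>x. a * h x)"
        by (simp add: \<delta>_def f_def vec_nth_vec_lambda)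
      then show ?thesis
        using pos unfolding dirichlet_scale a by (simp add: field_simps)
    next
      case False
      then show ?thesis
        by (simp add: l2norm_sq_def dirichlet_def)
    qed
    then show ?thesis
      unfolding dh unfolding var[symmetric] h_def .
  qed
  have eig: "(\<Sum>y\<in>UNIV. P z y * f y) = (1 - \<delta>) * f z" for z
  proof -
    let ?e = "\<lambda>x. of_bool (x = z) :: real"
    define Pf where "Pf = (\<Sum>y\<in>UNIV. P z y * f y)"
    \<comment> \<open>This is \<open>gap\<close> for f plus t times the indicator of z. Since f
      attains equality, the constant terms cancel and a quadratic without constant term
      remains.\<close>
    have "0 \<le> 2 * t * (\<nu> z * (f z - Pf) - \<delta> * (\<nu> z * f z)) + t\<^sup>2 * (dirichlet P \<nu> ?e - \<delta> * (\<nu> z - (\<nu> z)\<^sup>2))" for t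
    proof -
      have 1: "l2norm_sq (\<lambda>x. f x + t * ?e x) \<nu> = l2norm_sq f \<nu> + 2 * t * (\<nu> z * f z) + t\<^sup>2 * \<nu> z"
      proof -
        have "l2norm_sq (\<lambda>x. f x + t * ?e x) \<nu> =
            (\<Sum>x\<in>UNIV. (f x)\<^sup>2 * \<nu> x + (if x = z then 2 * t * (\<nu> x * f x) + t\<^sup>2 * \<nu> x else 0))"
          unfolding l2norm_sq_def by (intro sum.cong) (auto simp: power2_sum algebra_simps)
        then show ?thesis
          by (simp add: sum.distrib l2norm_sq_def)
      qed
      have 2: "mean (\<lambda>x. f x + t * ?e x) \<nu> = t * \<nu> z"
      proof -
        have "mean (\<lambda>x. f x + t * ?e x) \<nu> = (\<Sum>x\<in>UNIV. f x * \<nu> x + (if x = z then t * \<nu> x else 0))"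
          unfolding mean_def by (intro sum.cong) (auto simp: algebra_simps)
        then show ?thesis
          using f(2) by (simp add: sum.distrib mean_def)
      qed
      show ?thesis
        using gap[of "\<lambda>x. f x + t * ?e x"]
        unfolding 1 2 dirichlet_perturb_indicator[OF rev one] f(1) \<delta>_def[symmetric] Pf_def[symmetric]
        by (simp add: power2_eq_square algebra_simps)
    qed
    then have "\<nu> z * (f z - Pf) - \<delta> * (\<nu> z * f z) = 0"
      by (rule nonneg_quadratic_linear_coeff)
    then have "\<nu> z * (f z - Pf - \<delta> * f z) = 0"
      by (simp add: algebra_simps)
    then have "f z - Pf - \<delta> * f z = 0"
      unfolding mult_eq_0_iff using \<nu>0[of z] by auto
    then show ?thesis
      by (simp add: Pf_def algebra_simps)
  qed
  have nonconst: "\<exists>j k. f j \<noteq> f k"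
  proof (rule ccontr)
    assume "\<not> ?thesis"
    then have const: "f y = f u" for y
      by blast
    then have "mean f \<nu> = f u"
      unfolding mean_def by (subst const) (simp add: sum_distrib_left[symmetric] \<nu>1)
    then have "f = (\<lambda>_. 0)"
      using const f(2) by auto
    then show False
      using f(1) by (simp add: l2norm_sq_def)
  qed
  have "0 \<le> \<delta>"
    unfolding \<delta>_def dirichlet_def using Pn \<nu>0 by (auto intro!: sum_nonneg mult_nonneg_nonneg simp: less_imp_le)
  with nonconst show thesis
    using that[of f "1 - \<delta>"] eig gap by auto
qed

text \<open>A bound of \<rho> by the second root, rather than equality, suffices: a larger second
  eigenvalue only weakens the final estimate.\<close>

lemma second_eig_poincare:
  fixes P :: "'v::finite \<Rightarrow> 'v \<Rightarrow> real"
  assumes rev: "\<And>x y. \<nu> x * P x y = \<nu> y * P y x" and P: "markov_kernel P"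
    and \<nu>: "pos_prob \<nu>" and "u \<noteq> (w :: 'v)"
  obtains \<rho> where "\<rho> \<le> second_eig P" and "\<rho> \<le> 1"
    and "\<And>g. (1 - \<rho>) * (l2norm_sq g \<nu> - (mean g \<nu>)\<^sup>2) \<le> dirichlet P \<nu> g"
proof (rule exists_second_eigenvector[OF assms])
  fix \<rho> :: real and f j k
  assume f: "\<And>x. (\<Sum>y\<in>UNIV. P x y * f y) = \<rho> * f x" "f j \<noteq> f k" and "\<rho> \<le> 1"
    and gap: "\<And>g. (1 - \<rho>) * (l2norm_sq g \<nu> - (mean g \<nu>)\<^sup>2) \<le> dirichlet P \<nu> g"
  have "\<And>x. (\<Sum>y\<in>UNIV. P x y) = 1"
    using P by (simp add: markov_kernel_def)
  then have "\<rho> \<le> second_eig P"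
    using f \<open>\<rho> \<le> 1\<close> P by (intro second_eig_ge linear_factors_dvd_charpoly)
  with gap \<open>\<rho> \<le> 1\<close> show thesis
    using that by blast
qed

subsection \<open>Entropy and the logarithmic Sobolev constant\<close>

lemma powr_above_tangent:
  fixes s t u :: real
  assumes "1 \<le> s" "0 \<le> t" "0 < u"
  shows "u powr s + s * u powr (s - 1) * (t - u) \<le> t powr s"
\<comment> \<open>The tangent argument is run at positive t; at t = 0 the claim reduces to u powr s
  \<le> s * u powr s.\<close>
proof (cases "t = 0")
  case True
  have "u powr s = u powr (s - 1) * u"
    using assms by (simp add: powr_diff)
  moreover have "u powr s \<le> s * u powr s"
    using assms by (simp add: mult_le_cancel_right1)
  ultimately show ?thesis
    using True by (simp add: mult.assoc)
next
  case False
  have "s * u powr (s - 1) * (t - u) \<le> t powr s - u powr s"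
    using assms False
    by (intro convex_on_imp_above_tangent[OF powr_convex])
      (auto simp: interior_open intro!: derivative_eq_intros)
  then show ?thesis
    by simp
qed

text \<open>Jensen's inequality: average the tangent inequality at the weighted mean u, where the
  linear term drops out.\<close>

lemma powr_sum_le_sum_powr:
  fixes a g :: "'v::finite \<Rightarrow> real"
  assumes "1 \<le> s" and "\<And>y. 0 \<le> a y" and "(\<Sum>y\<in>UNIV. a y) = 1" and "\<And>y. 0 \<le> g y"
  shows "(\<Sum>y\<in>UNIV. a y * g y) powr s \<le> (\<Sum>y\<in>UNIV. a y * g y powr s)"
proof -
  define u where "u = (\<Sum>y\<in>UNIV. a y * g y)"
  have "0 \<le> u"
    unfolding u_def using assms by (intro sum_nonneg) auto
  show ?thesis
  proof (cases "u = 0")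
    case True
    then show ?thesis
      using assms by (simp add: u_def[symmetric] sum_nonneg)
  next
    case False
    with \<open>0 \<le> u\<close> have "0 < u"
      by simp
    let ?d = "s * u powr (s - 1)"
    have "u powr s = (\<Sum>y\<in>UNIV. a y) * (u powr s - ?d * u) + ?d * u"
      using assms by simp
    also have "\<dots> = (\<Sum>y\<in>UNIV. a y * (u powr s - ?d * u)) + (\<Sum>y\<in>UNIV. ?d * (a y * g y))"
      by (simp add: u_def[symmetric] sum_distrib_left[symmetric] sum_distrib_right[symmetric])
    also have "\<dots> = (\<Sum>y\<in>UNIV. a y * (u powr s + ?d * (g y - u)))"
      by (simp add: sum.distrib[symmetric] algebra_simps)
    also have "\<dots> \<le> (\<Sum>y\<in>UNIV. a y * g y powr s)"
      using assms \<open>0 < u\<close> by (intro sum_mono mult_left_mono powr_above_tangent) auto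
    finally show ?thesis
      by (simp add: u_def)
  qed
qed

section \<open>Entropy as a minimum, and its bound by norms\<close>

lemma l2norm_sq_nonneg: "(\<And>x. 0 \<le> \<nu> x) \<Longrightarrow> 0 \<le> l2norm_sq f \<nu>"
  by (simp add: l2norm_sq_def sum_nonneg)

lemma l2norm_sq_eq_0D:
  assumes "pos_prob \<nu>" and "l2norm_sq f \<nu> = 0"
  shows "f x = 0"
  using assms unfolding l2norm_sq_def pos_prob_def
  by (subst (asm) sum_nonneg_eq_0_iff) (auto simp: less_imp_le less_imp_neq[THEN not_sym])

text \<open>This is the Bregman divergence of t log t between t and a; nonnegativity is ln s \<le> s
  - 1 at s = a/t, multiplied by t.\<close>

lemma entropy_integrand_nonneg:
  fixes t a :: real
  assumes "0 \<le> t" "0 < a"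
  shows "0 \<le> t * ln (t / a) - t + a"
proof (cases "t = 0")
  case False
  with assms have "0 < t"
    by simp
  then have "ln (a / t) \<le> a / t - 1"
    using assms by (intro ln_le_minus_one) auto
  then have "t * ln (a / t) \<le> t * (a / t - 1)"
    using \<open>0 < t\<close> by simp
  also have "\<dots> = a - t"
    using \<open>0 < t\<close> by (simp add: field_simps)
  finally show ?thesis
    using \<open>0 < t\<close> \<open>0 < a\<close> by (simp add: ln_div algebra_simps)
qed (use assms in auto)

text \<open>Split the logarithm at the mean m of f^2. The excess over the entropy is the same
  Bregman integrand at (m, a), hence nonnegative and zero at a = m.\<close>

lemma entropy_L_variational:
  assumes "pos_prob \<nu>" and "0 < l2norm_sq f \<nu>" and "0 < a"
  shows "(\<Sum>x\<in>UNIV. ((f x)\<^sup>2 * ln ((f x)\<^sup>2 / a) - (f x)\<^sup>2 + a) * \<nu> x) =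
    entropy_L f \<nu> + (l2norm_sq f \<nu> * ln (l2norm_sq f \<nu> / a) - l2norm_sq f \<nu> + a)"
proof -
  define m where "m = l2norm_sq f \<nu>"
  have "((f x)\<^sup>2 * ln ((f x)\<^sup>2 / a) - (f x)\<^sup>2 + a) * \<nu> x =
      (f x)\<^sup>2 * ln ((f x)\<^sup>2 / m) * \<nu> x + (ln (m / a) - 1) * ((f x)\<^sup>2 * \<nu> x) + a * \<nu> x" for x
  proof (cases "f x = 0")
    case False
    then have "ln ((f x)\<^sup>2 / a) = ln ((f x)\<^sup>2 / m) + ln (m / a)"
      using assms by (simp add: m_def ln_div)
    then show ?thesis
      by (simp add: algebra_simps)
  qed auto
  then have "(\<Sum>x\<in>UNIV. ((f x)\<^sup>2 * ln ((f x)\<^sup>2 / a) - (f x)\<^sup>2 + a) * \<nu> x) =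
      entropy_L f \<nu> + (ln (m / a) - 1) * m + a"
    using assms(1) by (simp add: sum.distrib sum_distrib_left[symmetric] m_def entropy_L_def
        l2norm_sq_def pos_prob_def)
  then show ?thesis
    by (simp add: m_def algebra_simps)
qed

lemma entropy_L_eq_0: "(\<And>x. f x = 0) \<Longrightarrow> entropy_L f \<nu> = 0"
  by (simp add: entropy_L_def)

lemma entropy_L_nonneg:
  assumes "pos_prob \<nu>"
  shows "0 \<le> entropy_L f \<nu>"
proof (cases "l2norm_sq f \<nu> = 0")
  case True
  then show ?thesis
    using l2norm_sq_eq_0D[OF assms] entropy_L_eq_0[of f \<nu>] by simp
next
  case False
  then have m: "0 < l2norm_sq f \<nu>"
    using assms l2norm_sq_nonneg[of \<nu> f] by (simp add: pos_prob_def less_imp_le less_le)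
  have "0 \<le> (\<Sum>x\<in>UNIV. ((f x)\<^sup>2 * ln ((f x)\<^sup>2 / l2norm_sq f \<nu>) - (f x)\<^sup>2 + l2norm_sq f \<nu>) * \<nu> x)"
    using assms m by (intro sum_nonneg mult_nonneg_nonneg entropy_integrand_nonneg)
      (auto simp: pos_prob_def less_imp_le)
  then show ?thesis
    unfolding entropy_L_variational[OF assms m m] using m by simp
qed

text \<open>The entropy is the minimum over \<open>a\<close> of the integrals of the nonnegative functions
  \<open>f\<^sup>2 log (f\<^sup>2/a) - f\<^sup>2 + a\<close>, and each of these integrals is monotone in the measure.\<close>

lemma entropy_L_comparison:
  assumes "pos_prob \<nu>" and "pos_prob \<nu>'" and "\<And>x. \<nu>' x \<le> c * \<nu> x"
  shows "entropy_L f \<nu>' \<le> c * entropy_L f \<nu>"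
proof (cases "\<forall>x. f x = 0")
  case True
  then show ?thesis
    by (simp add: entropy_L_eq_0)
next
  case False
  have pos: "0 < l2norm_sq f \<kappa>" if "pos_prob \<kappa>" for \<kappa>
    using that False l2norm_sq_nonneg[of \<kappa> f] l2norm_sq_eq_0D[OF that, of f]
    by (force simp: pos_prob_def less_imp_le less_le)
  define a where "a = l2norm_sq f \<nu>"
  let ?e = "\<lambda>x. (f x)\<^sup>2 * ln ((f x)\<^sup>2 / a) - (f x)\<^sup>2 + a"
  have a: "0 < a" and m: "0 < l2norm_sq f \<nu>'"
    unfolding a_def using pos assms by auto
  have e: "0 \<le> ?e x" for x
    using a by (intro entropy_integrand_nonneg) auto
  have "entropy_L f \<nu>' \<le> (\<Sum>x\<in>UNIV. ?e x * \<nu>' x)"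
    unfolding entropy_L_variational[OF assms(2) m a] using entropy_integrand_nonneg[of "l2norm_sq f \<nu>'" a] m a
    by simp
  also have "\<dots> \<le> (\<Sum>x\<in>UNIV. ?e x * (c * \<nu> x))"
    using e assms(3) by (intro sum_mono mult_left_mono) auto
  also have "\<dots> = c * (\<Sum>x\<in>UNIV. ?e x * \<nu> x)"
    by (simp add: sum_distrib_left mult.left_commute)
  also have "(\<Sum>x\<in>UNIV. ?e x * \<nu> x) = entropy_L f \<nu>"
    using entropy_L_variational[OF assms(1) pos[OF assms(1)] a] a by (simp add: a_def)
  finally show ?thesis .
qed

text \<open>With m the squared norm and E the entropy, m exp (- l E / m) lies between the two sides.
  The left bound is 1 + u \<le> exp u. The right one is Jensen's inequality for exp under the
  probability f^2 \<nu> / m, applied to a negative multiple of ln (f^2 / m), whose mean is E /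
  m.\<close>

lemma l2norm_sq_minus_entropy_le:
  assumes "pos_prob \<nu>" and "0 \<le> l"
  shows "l2norm_sq f \<nu> - l * entropy_L f \<nu> \<le> (\<Sum>x\<in>UNIV. ((f x)\<^sup>2) powr (1 / (1 + l)) * \<nu> x) powr (1 + l)"
proof (cases "l2norm_sq f \<nu> = 0")
  case True
  then show ?thesis
    using l2norm_sq_eq_0D[OF assms(1) True] entropy_L_eq_0[of f \<nu>] by simp
next
  case False
  define m where "m = l2norm_sq f \<nu>"
  have m: "0 < m"
    using False assms l2norm_sq_nonneg[of \<nu> f] by (simp add: m_def pos_prob_def less_imp_le less_le)
  define a where "a = entropy_L f \<nu> / m"
  define \<alpha> where "\<alpha> = l / (1 + l)"
  have \<alpha>: "1 / (1 + l) = 1 - \<alpha>" "0 \<le> \<alpha>"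
    using assms(2) by (auto simp: \<alpha>_def field_simps)
  have eq: "(1 - \<alpha>) * (1 + l) = 1" "\<alpha> * a * (1 + l) = l * a"
    using assms(2) by (auto simp: \<alpha>(1)[symmetric]) (simp add: \<alpha>_def)
  define C where "C = m powr (- \<alpha>) * exp (- \<alpha> * a)"
  \<comment> \<open>The tangent of exp at - \<alpha> * a, evaluated at - \<alpha> * ln (F / m) and
    multiplied by F * m powr (- \<alpha>), with F = f^2.\<close>
  have point: "C * (f x)\<^sup>2 * (1 + \<alpha> * a) - C * \<alpha> * ((f x)\<^sup>2 * ln ((f x)\<^sup>2 / m)) \<le> ((f x)\<^sup>2) powr (1 / (1 + l))" for x
  proof (cases "f x = 0")
    case False
    define F where "F = (f x)\<^sup>2"
    have F: "0 < F"
      using False by (simp add: F_def)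
    have "C * F * (1 - \<alpha> * (ln (F / m) - a)) \<le> C * F * exp (- \<alpha> * (ln (F / m) - a))"
      using exp_ge_add_one_self[of "- \<alpha> * (ln (F / m) - a)"] F m
      by (intro mult_left_mono) (auto simp: C_def)
    also have "\<dots> = exp (ln F - \<alpha> * ln m - \<alpha> * a - \<alpha> * (ln F - ln m - a))"
      using F m by (simp add: C_def powr_def ln_div exp_diff exp_minus exp_add field_simps)
    also have "ln F - \<alpha> * ln m - \<alpha> * a - \<alpha> * (ln F - ln m - a) = (1 - \<alpha>) * ln F"
      by (simp add: algebra_simps)
    also have "exp ((1 - \<alpha>) * ln F) = F powr (1 / (1 + l))"
      using F by (simp add: powr_def \<alpha>(1))
    finally show ?thesis
      unfolding F_def by (simp add: algebra_simps)
  qed simp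
  have "m powr (1 - \<alpha>) * exp (- \<alpha> * a) = C * m"
    using m by (simp add: C_def powr_diff powr_minus field_simps)
  also have "\<dots> = C * (1 + \<alpha> * a) * m - C * \<alpha> * entropy_L f \<nu>"
    using m by (simp add: a_def field_simps)
  also have "\<dots> = (\<Sum>x\<in>UNIV. (C * (f x)\<^sup>2 * (1 + \<alpha> * a) - C * \<alpha> * ((f x)\<^sup>2 * ln ((f x)\<^sup>2 / m))) * \<nu> x)"
    by (simp add: m_def l2norm_sq_def entropy_L_def sum_distrib_left sum_subtractf[symmetric] algebra_simps)
  also have "\<dots> \<le> (\<Sum>x\<in>UNIV. ((f x)\<^sup>2) powr (1 / (1 + l)) * \<nu> x)"
    using point assms(1) by (intro sum_mono mult_right_mono) (auto simp: pos_prob_def less_imp_le)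
  finally have "(m powr (1 - \<alpha>) * exp (- \<alpha> * a)) powr (1 + l) \<le>
      (\<Sum>x\<in>UNIV. ((f x)\<^sup>2) powr (1 / (1 + l)) * \<nu> x) powr (1 + l)"
    using assms(2) by (intro powr_mono2) auto
  moreover have "(m powr (1 - \<alpha>) * exp (- \<alpha> * a)) powr (1 + l) = m * exp (- l * a)"
    using m eq by (simp add: powr_mult powr_powr exp_powr_real)
  moreover have "m * (1 - l * a) \<le> m * exp (- l * a)"
    using m exp_ge_add_one_self[of "- l * a"] by (intro mult_left_mono) auto
  moreover have "m * (1 - l * a) = m - l * entropy_L f \<nu>"
    using m by (simp add: a_def field_simps)
  ultimately show ?thesis
    unfolding m_def by linarith
qed

section \<open>The logarithmic Sobolev constant as an infimum\<close>

lemma entropy_L_const: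
  assumes "pos_prob \<nu>" and "\<And>x y. f x = f y"
  shows "entropy_L f \<nu> = 0"
proof -
  obtain a where a: "f = (\<lambda>_. a)"
    using assms(2) by (metis (mono_tags) ext)
  have "l2norm_sq f \<nu> = a\<^sup>2"
    using assms(1) by (simp add: a l2norm_sq_def sum_distrib_left[symmetric] pos_prob_def)
  then show ?thesis
    by (cases "a = 0") (simp_all add: a entropy_L_def)
qed

lemma dirichlet_nonneg:
  assumes "\<And>x y. 0 \<le> P x y" and "\<And>x. 0 \<le> \<nu> x"
  shows "0 \<le> dirichlet P \<nu> f"
  unfolding dirichlet_def using assms by (auto intro!: sum_nonneg mult_nonneg_nonneg)

text \<open>For zero entropy only nonnegativity of the form is claimed. Otherwise f is nonconstant
  and its quotient lies in the set of the infimum, which is bounded below by 0 as the real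
  \<open>Inf\<close> requires.\<close>

lemma logsob_mult_entropy_le:
  assumes P: "\<And>x y. 0 \<le> P x y" and \<nu>: "pos_prob \<nu>"
  shows "logsob P \<nu> * entropy_L f \<nu> \<le> dirichlet P \<nu> f"
proof (cases "entropy_L f \<nu> = 0")
  case True
  then show ?thesis
    using dirichlet_nonneg[of P \<nu> f] P \<nu> by (simp add: pos_prob_def less_imp_le)
next
  case False
  then have "\<exists>x y. f x \<noteq> f y"
    using entropy_L_const[OF \<nu>] by blast
  then have "logsob P \<nu> \<le> dirichlet P \<nu> f / entropy_L f \<nu>"
    unfolding logsob_def using False P \<nu>
    by (intro cInf_lower bdd_belowI[of _ 0])
      (auto simp: pos_prob_def less_imp_le intro!: divide_nonneg_nonneg dirichlet_nonneg entropy_L_nonneg[OF \<nu>])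
  moreover have "0 < entropy_L f \<nu>"
    using False entropy_L_nonneg[OF \<nu>, of f] by simp
  ultimately show ?thesis
    by (simp add: field_simps)
qed

text \<open>A lower bound for a real \<open>Inf\<close> needs a nonempty set. The indicator of u
  provides an element: the second point forces \<nu> u < 1, so its entropy is nonzero.\<close>

lemma logsob_nonneg:
  fixes P :: "'v::finite \<Rightarrow> 'v \<Rightarrow> real"
  assumes P: "\<And>x y. 0 \<le> P x y" and \<nu>: "pos_prob \<nu>" and "u \<noteq> (w :: 'v)"
  shows "0 \<le> logsob P \<nu>"
proof -
  let ?e = "\<lambda>x. of_bool (x = u) :: real"
  have "\<nu> u + \<nu> w \<le> sum \<nu> UNIV"
    using \<nu> \<open>u \<noteq> w\<close> sum_mono2[of UNIV "{u, w}" \<nu>] by (simp add: pos_prob_def less_imp_le)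
  then have "0 < \<nu> u" "\<nu> u < 1"
    using \<nu> unfolding pos_prob_def by (auto simp: add.commute intro: less_le_trans[of _ "\<nu> u + \<nu> w"])
  moreover have "l2norm_sq ?e \<nu> = \<nu> u"
    by (simp add: l2norm_sq_def of_bool_def if_distrib[of "\<lambda>a. a * _"] if_distrib[of "\<lambda>a. a ^ 2"] cong: if_cong)
  then have "entropy_L ?e \<nu> = ln (1 / \<nu> u) * \<nu> u"
    unfolding entropy_L_def by (simp add: of_bool_def if_distrib[of "\<lambda>a. a * _"] if_distrib[of "\<lambda>a. a ^ 2"] cong: if_cong)
  ultimately have "entropy_L ?e \<nu> \<noteq> 0"
    by (simp add: ln_div)
  moreover have "?e u \<noteq> ?e w"
    using \<open>u \<noteq> w\<close> by simp
  ultimately have "{dirichlet P \<nu> f / entropy_L f \<nu> |f. entropy_L f \<nu> \<noteq> 0 \<and> (\<exists>x y. f x \<noteq> f y)} \<noteq> {}"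
    by blast
  then show ?thesis
    unfolding logsob_def using P \<nu>
    by (intro cInf_greatest)
      (auto simp: pos_prob_def less_imp_le intro!: divide_nonneg_nonneg dirichlet_nonneg entropy_L_nonneg[OF \<nu>])
qed

subsection \<open>One step of the chain\<close>

definition kapp :: "('v::finite \<Rightarrow> 'v \<Rightarrow> real) \<Rightarrow> ('v \<Rightarrow> real) \<Rightarrow> 'v \<Rightarrow> real" where
  "kapp A f x = (\<Sum>y\<in>UNIV. A x y * f y)"

lemma kapp_nonneg: "markov_kernel A \<Longrightarrow> (\<And>y. 0 \<le> f y) \<Longrightarrow> 0 \<le> kapp A f x"
  unfolding kapp_def markov_kernel_def by (intro sum_nonneg) auto

lemma kapp_idm: "kapp idm f = f"
  by (auto simp: kapp_def idm_def if_distrib[of "\<lambda>a. a * _"] cong: if_cong)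

lemma kapp_mmul: "kapp (mmul A B) f = kapp A (kapp B f)"
proof
  fix x
  have "kapp (mmul A B) f x = (\<Sum>y\<in>UNIV. \<Sum>z\<in>UNIV. A x z * B z y * f y)"
    by (simp add: kapp_def mmul_def sum_distrib_right)
  also have "\<dots> = kapp A (kapp B f) x"
    by (subst sum.swap) (simp add: kapp_def sum_distrib_left mult.assoc)
  finally show "kapp (mmul A B) f x = kapp A (kapp B f) x" .
qed

lemma vmul_mmul: "vmul \<mu> (mmul A B) = vmul (vmul \<mu> A) B"
proof
  fix y
  have "vmul \<mu> (mmul A B) y = (\<Sum>x\<in>UNIV. \<Sum>z\<in>UNIV. \<mu> x * A x z * B z y)"
    by (simp add: vmul_def mmul_def sum_distrib_left mult.assoc)
  also have "\<dots> = vmul (vmul \<mu> A) B y"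
    by (subst sum.swap) (simp add: vmul_def sum_distrib_right)
  finally show "vmul \<mu> (mmul A B) y = vmul (vmul \<mu> A) B y" .
qed

lemma sum_kapp_eq_sum_vmul:
  "(\<Sum>x\<in>UNIV. \<mu> x * kapp A f x) = (\<Sum>y\<in>UNIV. vmul \<mu> A y * f y)"
proof -
  have "(\<Sum>x\<in>UNIV. \<mu> x * kapp A f x) = (\<Sum>x\<in>UNIV. \<Sum>y\<in>UNIV. \<mu> x * A x y * f y)"
    by (simp add: kapp_def sum_distrib_left mult.assoc)
  also have "\<dots> = (\<Sum>y\<in>UNIV. vmul \<mu> A y * f y)"
    by (subst sum.swap) (simp add: vmul_def sum_distrib_right)
  finally show ?thesis .
qed

lemma sum_vmul:
  assumes "markov_kernel A"
  shows "sum (vmul \<mu> A) UNIV = sum \<mu> UNIV"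
  using sum_kapp_eq_sum_vmul[of \<mu> A "\<lambda>_. 1"] assms by (simp add: kapp_def markov_kernel_def)

lemma markov_kernel_mmul:
  assumes A: "markov_kernel A" and B: "markov_kernel B"
  shows "markov_kernel (mmul A B)"
proof -
  have "(\<Sum>y\<in>UNIV. mmul A B x y) = 1" for x
    using fun_cong[OF kapp_mmul[of A B "\<lambda>_. 1"], of x] A B by (simp add: kapp_def markov_kernel_def)
  moreover have "0 \<le> mmul A B x y" for x y
    using A B by (auto simp: markov_kernel_def mmul_def intro: sum_nonneg)
  ultimately show ?thesis
    by (simp add: markov_kernel_def)
qed

lemma markov_kernel_Kprod:
  assumes "\<And>i. i \<ge> 1 \<Longrightarrow> markov_kernel (K i)"
  shows "markov_kernel (Kprod K n)"
proof (induction n)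
  case 0
  show ?case
    by (auto simp: markov_kernel_def idm_def)
next
  case (Suc n)
  then show ?case
    using assms by (simp add: markov_kernel_mmul)
qed

lemma mu_n_0: "mu_n \<mu> K 0 = \<mu>"
  by (auto simp: mu_n_def vmul_def idm_def if_distrib[of "\<lambda>a. _ * a"] cong: if_cong)

lemma mu_n_Suc: "mu_n \<mu> K (Suc n) = vmul (mu_n \<mu> K n) (K (Suc n))"
  by (simp add: mu_n_def vmul_mmul)

section \<open>The reversible kernel of one step and its Dirichlet form\<close>

lemma adjprod_weight:
  assumes "0 < vmul \<mu> A x"
  shows "vmul \<mu> A x * adjprod A \<mu> x y = (\<Sum>z\<in>UNIV. \<mu> z * A z x * A z y)"
  using assms by (simp add: adjprod_def)

lemma markov_kernel_adjprod:
  assumes A: "markov_kernel A" and \<mu>: "\<And>z. 0 \<le> \<mu> z" and pos: "\<And>x. 0 < vmul \<mu> A x"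
  shows "markov_kernel (adjprod A \<mu>)"
proof -
  have "0 \<le> adjprod A \<mu> x y" for x y
    unfolding adjprod_def using A \<mu> pos[of x]
    by (intro mult_nonneg_nonneg sum_nonneg) (auto simp: markov_kernel_def)
  moreover have "(\<Sum>y\<in>UNIV. adjprod A \<mu> x y) = 1" for x
  proof -
    have "(\<Sum>y\<in>UNIV. vmul \<mu> A x * adjprod A \<mu> x y) = (\<Sum>z\<in>UNIV. \<Sum>y\<in>UNIV. \<mu> z * A z x * A z y)"
      unfolding adjprod_weight[OF pos] by (rule sum.swap)
    also have "\<dots> = vmul \<mu> A x"
      using A by (simp add: sum_distrib_left[symmetric] markov_kernel_def vmul_def)
    finally show ?thesis
      using pos[of x] by (simp add: sum_distrib_left[symmetric])
  qed
  ultimately show ?thesis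
    by (simp add: markov_kernel_def)
qed

lemma adjprod_reversible:
  assumes "\<And>x. 0 < vmul \<mu> A x"
  shows "vmul \<mu> A x * adjprod A \<mu> x y = vmul \<mu> A y * adjprod A \<mu> y x"
  by (simp add: adjprod_weight assms mult.commute mult.left_commute)

text \<open>The normalization in \<open>adjprod\<close> cancels against the weight, so the form is
  linear in \<mu>, although the kernel itself is not. This is what makes forms over two base
  measures comparable.\<close>

lemma dirichlet_adjprod:
  assumes pos: "\<And>x. 0 < vmul \<mu> A x"
  shows "dirichlet (adjprod A \<mu>) (vmul \<mu> A) f =
    (\<Sum>z\<in>UNIV. \<mu> z * (1/2 * (\<Sum>x\<in>UNIV. \<Sum>y\<in>UNIV. (f x - f y)\<^sup>2 * (A z x * A z y))))"
proof -
  have "dirichlet (adjprod A \<mu>) (vmul \<mu> A) f =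
      1/2 * (\<Sum>x\<in>UNIV. \<Sum>y\<in>UNIV. \<Sum>z\<in>UNIV. \<mu> z * ((f x - f y)\<^sup>2 * (A z x * A z y)))"
    unfolding dirichlet_def mult.assoc adjprod_weight[OF pos] sum_distrib_left
    by (simp add: mult_ac)
  also have "(\<Sum>x\<in>UNIV. \<Sum>y\<in>UNIV. \<Sum>z\<in>UNIV. \<mu> z * ((f x - f y)\<^sup>2 * (A z x * A z y))) =
      (\<Sum>x\<in>UNIV. \<Sum>z\<in>UNIV. \<Sum>y\<in>UNIV. \<mu> z * ((f x - f y)\<^sup>2 * (A z x * A z y)))"
    by (intro sum.cong refl sum.swap)
  also have "\<dots> = (\<Sum>z\<in>UNIV. \<Sum>x\<in>UNIV. \<Sum>y\<in>UNIV. \<mu> z * ((f x - f y)\<^sup>2 * (A z x * A z y)))"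
    by (rule sum.swap)
  finally show ?thesis
    by (simp add: sum_distrib_left mult.left_commute)
qed

text \<open>The inner term at z is the variance of f under the law A z, so the form is the squared
  norm lost in one step. Both the hypercontractive and the variance estimate start from this
  identity.\<close>

lemma dirichlet_adjprod_eq:
  assumes A: "markov_kernel A" and pos: "\<And>x. 0 < vmul \<mu> A x"
  shows "dirichlet (adjprod A \<mu>) (vmul \<mu> A) f = l2norm_sq f (vmul \<mu> A) - l2norm_sq (kapp A f) \<mu>"
proof -
  have one: "(\<Sum>y\<in>UNIV. A z y) = 1" for z
    using A by (simp add: markov_kernel_def)
  have "1/2 * (\<Sum>x\<in>UNIV. \<Sum>y\<in>UNIV. (f x - f y)\<^sup>2 * (A z x * A z y)) =
      kapp A (\<lambda>x. (f x)\<^sup>2) z - (kapp A f z)\<^sup>2" for z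
  proof -
    have "(\<Sum>x\<in>UNIV. \<Sum>y\<in>UNIV. (f x - f y)\<^sup>2 * (A z x * A z y)) =
        (\<Sum>x\<in>UNIV. \<Sum>y\<in>UNIV. A z x * (f x)\<^sup>2 * A z y + A z x * (A z y * (f y)\<^sup>2)
          - 2 * (A z x * f x * (A z y * f y)))"
      by (intro sum.cong refl) (simp add: power2_eq_square algebra_simps)
    also have "\<dots> = 2 * kapp A (\<lambda>x. (f x)\<^sup>2) z - 2 * (kapp A f z)\<^sup>2"
      by (simp add: sum.distrib sum_subtractf sum_distrib_left[symmetric] sum_distrib_right[symmetric]
          one kapp_def power2_eq_square)
    finally show ?thesis
      by simp
  qed
  then have "dirichlet (adjprod A \<mu>) (vmul \<mu> A) f =
      (\<Sum>z\<in>UNIV. \<mu> z * kapp A (\<lambda>x. (f x)\<^sup>2) z) - (\<Sum>z\<in>UNIV. \<mu> z * (kapp A f z)\<^sup>2)"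
    unfolding dirichlet_adjprod[OF pos] by (simp add: right_diff_distrib sum_subtractf)
  then show ?thesis
    by (simp add: sum_kapp_eq_sum_vmul l2norm_sq_def mult.commute)
qed

section \<open>Comparison between two base measures\<close>

lemma dirichlet_adjprod_comparison:
  assumes A: "markov_kernel A" and "\<And>x. 0 < vmul \<mu> A x" and "\<And>x. 0 < vmul \<mu>' A x"
    and le: "\<And>x. \<mu>' x \<le> c * \<mu> x"
  shows "dirichlet (adjprod A \<mu>') (vmul \<mu>' A) f \<le> c * dirichlet (adjprod A \<mu>) (vmul \<mu> A) f"
proof -
  let ?q = "\<lambda>z. 1/2 * (\<Sum>x\<in>UNIV. \<Sum>y\<in>UNIV. (f x - f y)\<^sup>2 * (A z x * A z y))"
  have "dirichlet (adjprod A \<mu>') (vmul \<mu>' A) f = (\<Sum>z\<in>UNIV. \<mu>' z * ?q z)"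
    using assms(3) by (rule dirichlet_adjprod)
  also have "\<dots> \<le> (\<Sum>z\<in>UNIV. (c * \<mu> z) * ?q z)"
    using A le by (intro sum_mono mult_right_mono mult_nonneg_nonneg sum_nonneg) (auto simp: markov_kernel_def)
  also have "\<dots> = c * (\<Sum>z\<in>UNIV. \<mu> z * ?q z)"
    by (simp only: sum_distrib_left mult.assoc)
  also have "(\<Sum>z\<in>UNIV. \<mu> z * ?q z) = dirichlet (adjprod A \<mu>) (vmul \<mu> A) f"
    using assms(2) by (rule dirichlet_adjprod[symmetric])
  finally show ?thesis .
qed

text \<open>The variance is the minimum over a of the integral of (g - a)^2. Testing the left side
  with the mean under \<nu> leaves integrals of one nonnegative function.\<close>

lemma variance_comparison:
  assumes "pos_prob \<nu>" and "pos_prob \<nu>'" and le: "\<And>x. \<nu>' x \<le> c * \<nu> x"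
  shows "l2norm_sq g \<nu>' - (mean g \<nu>')\<^sup>2 \<le> c * (l2norm_sq g \<nu> - (mean g \<nu>)\<^sup>2)"
proof -
  let ?a = "mean g \<nu>"
  have "l2norm_sq g \<nu>' - (mean g \<nu>')\<^sup>2 \<le> l2norm_sq (\<lambda>x. g x - ?a) \<nu>'"
    using zero_le_power2[of "mean g \<nu>' - ?a"]
    by (simp add: l2norm_sq_shift[OF assms(2)] power2_eq_square algebra_simps)
  also have "\<dots> \<le> (\<Sum>x\<in>UNIV. (g x - ?a)\<^sup>2 * (c * \<nu> x))"
    unfolding l2norm_sq_def using le by (intro sum_mono mult_left_mono) auto
  also have "\<dots> = c * l2norm_sq (\<lambda>x. g x - ?a) \<nu>"
    by (simp add: l2norm_sq_def sum_distrib_left mult.left_commute)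
  also have "l2norm_sq (\<lambda>x. g x - ?a) \<nu> = l2norm_sq g \<nu> - ?a\<^sup>2"
    by (simp add: l2norm_sq_shift[OF assms(1)] power2_eq_square)
  finally show ?thesis .
qed

lemma vmul_le:
  assumes "markov_kernel A" and "\<And>x. \<mu>' x \<le> c * \<mu> x"
  shows "vmul \<mu>' A x \<le> c * vmul \<mu> A x"
proof -
  have "vmul \<mu>' A x \<le> (\<Sum>z\<in>UNIV. (c * \<mu> z) * A z x)"
    unfolding vmul_def using assms by (intro sum_mono mult_right_mono) (auto simp: markov_kernel_def)
  then show ?thesis
    by (simp add: vmul_def sum_distrib_left mult.assoc)
qed

text \<open>A Markov kernel may have a zero column, so positivity is inherited from
  \<open>vmul \<mu> A\<close> through the comparison.\<close>

lemma comparison_pos_prob_vmul: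
  assumes A: "markov_kernel A" and \<mu>0: "pos_prob \<mu>0" and "pos_prob (vmul \<mu> A)" and "0 < c"
    and up: "\<And>x. \<mu> x \<le> c * \<mu>0 x"
  shows "pos_prob (vmul \<mu>0 A)"
proof -
  have "vmul \<mu> A x \<le> c * vmul \<mu>0 A x" for x
    using A up by (rule vmul_le)
  then have "0 < c * vmul \<mu>0 A x" for x
    using assms(3) by (auto simp: pos_prob_def intro: less_le_trans)
  then show ?thesis
    using \<mu>0 \<open>0 < c\<close> sum_vmul[OF A] by (simp add: pos_prob_def zero_less_mult_iff)
qed

text \<open>One factor c is lost in passing the entropy from \<mu> to \<mu>0, by \<open>up\<close>,
  and a second in passing the Dirichlet form back, by \<open>low\<close>.\<close>

lemma comparison_log_sobolev:
  assumes A: "markov_kernel A" and \<mu>0: "pos_prob \<mu>0" and \<nu>: "pos_prob (vmul \<mu> A)" and "0 < c"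
    and up: "\<And>x. \<mu> x \<le> c * \<mu>0 x" and low: "\<And>x. \<mu>0 x \<le> c * \<mu> x"
    and "u \<noteq> (w :: 'v::finite)"
  shows "c powr (-2) * logsob (adjprod A \<mu>0) (vmul \<mu>0 A) * entropy_L f (vmul \<mu> A)
    \<le> dirichlet (adjprod A \<mu>) (vmul \<mu> A) (f :: 'v \<Rightarrow> real)"
proof -
  let ?l = "logsob (adjprod A \<mu>0) (vmul \<mu>0 A)"
  have \<nu>0: "pos_prob (vmul \<mu>0 A)"
    using comparison_pos_prob_vmul[OF A \<mu>0 \<nu> \<open>0 < c\<close> up] .
  have P: "0 \<le> adjprod A \<mu>0 x y" for x y
    using markov_kernel_adjprod[OF A, of \<mu>0] \<mu>0 \<nu>0 by (simp add: pos_prob_def markov_kernel_def less_imp_le)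
  have "?l * entropy_L f (vmul \<mu> A) \<le> ?l * (c * entropy_L f (vmul \<mu>0 A))"
    by (intro mult_left_mono entropy_L_comparison[OF \<nu>0 \<nu>] vmul_le[OF A up] logsob_nonneg[OF P \<nu>0 \<open>u \<noteq> w\<close>])
  also have "\<dots> = c * (?l * entropy_L f (vmul \<mu>0 A))"
    by simp
  also have "\<dots> \<le> c * dirichlet (adjprod A \<mu>0) (vmul \<mu>0 A) f"
    using \<open>0 < c\<close> by (intro mult_left_mono logsob_mult_entropy_le[OF P \<nu>0]) auto
  also have "\<dots> \<le> c * (c * dirichlet (adjprod A \<mu>) (vmul \<mu> A) f)"
    using \<open>0 < c\<close> \<nu> \<nu>0 by (intro mult_left_mono dirichlet_adjprod_comparison[OF A _ _ low]) (auto simp: pos_prob_def)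
  finally have "c powr (-2) * (?l * entropy_L f (vmul \<mu> A)) \<le>
      c powr (-2) * (c * (c * dirichlet (adjprod A \<mu>) (vmul \<mu> A) f))"
    by (intro mult_left_mono) auto
  also have "\<dots> = dirichlet (adjprod A \<mu>) (vmul \<mu> A) f"
    using \<open>0 < c\<close> by (simp add: powr_minus powr_numeral field_simps power2_eq_square)
  finally show ?thesis
    by (simp add: mult.assoc)
qed

text \<open>Since a square is nonnegative, the factor is at least 1 - c^(-2), whatever the value of
  \<open>sigma1\<close>.\<close>

lemma contraction_factor_nonneg:
  assumes "1 < c"
  shows "0 \<le> 1 - c powr (-2) * (1 - (sigma1 A \<mu>)\<^sup>2)"
proof -
  have "c powr (-2) * (1 - (sigma1 A \<mu>)\<^sup>2) \<le> c powr (-2) * 1"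
    by (intro mult_left_mono) auto
  also have "c powr (-2) \<le> c powr 0"
    using assms by (intro powr_mono) auto
  finally show ?thesis
    using assms by simp
qed

text \<open>The same two comparisons as for the logarithmic Sobolev inequality, with variance in
  place of entropy and the gap 1 - \<rho> in place of the constant. As the form is the lost squared
  norm, a lower bound for it is a contraction.\<close>

lemma comparison_kapp_contraction:
  assumes A: "markov_kernel A" and \<mu>0: "pos_prob \<mu>0" and \<nu>: "pos_prob (vmul \<mu> A)" and "0 < c"
    and up: "\<And>x. \<mu> x \<le> c * \<mu>0 x" and low: "\<And>x. \<mu>0 x \<le> c * \<mu> x"
    and "u \<noteq> (w :: 'v::finite)" and "mean g (vmul \<mu> A) = 0"
  shows "l2norm_sq (kapp A g) \<mu> \<le>
    (1 - c powr (-2) * (1 - (sigma1 A \<mu>0)\<^sup>2)) * l2norm_sq (g :: 'v \<Rightarrow> real) (vmul \<mu> A)"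
proof -
  have \<nu>0: "pos_prob (vmul \<mu>0 A)"
    using comparison_pos_prob_vmul[OF A \<mu>0 \<nu> \<open>0 < c\<close> up] .
  then have pos0: "0 < vmul \<mu>0 A x" for x
    by (simp add: pos_prob_def)
  have pos: "0 < vmul \<mu> A x" for x
    using \<nu> by (simp add: pos_prob_def)
  have P: "markov_kernel (adjprod A \<mu>0)"
    using markov_kernel_adjprod[OF A, of \<mu>0] \<mu>0 pos0 by (simp add: pos_prob_def less_imp_le)
  obtain \<rho> where \<rho>: "\<rho> \<le> second_eig (adjprod A \<mu>0)" "\<rho> \<le> 1"
    and gap: "\<And>g. (1 - \<rho>) * (l2norm_sq g (vmul \<mu>0 A) - (mean g (vmul \<mu>0 A))\<^sup>2)
      \<le> dirichlet (adjprod A \<mu>0) (vmul \<mu>0 A) g"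
    using second_eig_poincare[OF adjprod_reversible[OF pos0] P \<nu>0 \<open>u \<noteq> w\<close>] by blast
  let ?V = "l2norm_sq g (vmul \<mu> A)" and ?D = "dirichlet (adjprod A \<mu>) (vmul \<mu> A) g"
  have "(1 - \<rho>) * ?V \<le> (1 - \<rho>) * (c * (l2norm_sq g (vmul \<mu>0 A) - (mean g (vmul \<mu>0 A))\<^sup>2))"
    using variance_comparison[OF \<nu>0 \<nu> vmul_le[OF A up], of g] \<rho> assms(8)
    by (intro mult_left_mono) auto
  also have "\<dots> = c * ((1 - \<rho>) * (l2norm_sq g (vmul \<mu>0 A) - (mean g (vmul \<mu>0 A))\<^sup>2))"
    by simp
  also have "\<dots> \<le> c * dirichlet (adjprod A \<mu>0) (vmul \<mu>0 A) g"
    using \<open>0 < c\<close> by (intro mult_left_mono gap) auto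
  also have "\<dots> \<le> c * (c * ?D)"
    using \<open>0 < c\<close> by (intro mult_left_mono dirichlet_adjprod_comparison[OF A pos pos0 low]) auto
  finally have "c powr (-2) * ((1 - \<rho>) * ?V) \<le> c powr (-2) * (c * (c * ?D))"
    by (intro mult_left_mono) auto
  also have "\<dots> = ?D"
    using \<open>0 < c\<close> by (simp add: powr_minus powr_numeral field_simps power2_eq_square)
  also have "?D = ?V - l2norm_sq (kapp A g) \<mu>"
    by (rule dirichlet_adjprod_eq[OF A pos])
  finally have 1: "c powr (-2) * ((1 - \<rho>) * ?V) \<le> ?V - l2norm_sq (kapp A g) \<mu>" .
  \<comment> \<open>\<open>sqrt\<close> of a negative number is negative in Isabelle, hence \<open>\<sigma>\<^sub>1\<^sup>2 = \<bar>\<lambda>\<^sub>1\<bar> \<ge> \<lambda>\<^sub>1\<close> without knowing the sign.\<close>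
  have "\<rho> \<le> (sigma1 A \<mu>0)\<^sup>2"
    using \<rho>(1) by (simp add: sigma1_def power2_eq_square)
  then have "c powr (-2) * ((1 - (sigma1 A \<mu>0)\<^sup>2) * ?V) \<le> c powr (-2) * ((1 - \<rho>) * ?V)"
    using \<nu> by (intro mult_left_mono mult_right_mono l2norm_sq_nonneg) (auto simp: pos_prob_def less_imp_le)
  with 1 show ?thesis
    by (simp add: left_diff_distrib mult.assoc)
qed

text \<open>The logarithmic Sobolev inequality is applied to \<open>G = g\<^sup>p\<close> with \<open>p = r (1 + l) / 2\<close>; Jensen's
  inequality gives \<open>(A g)\<^sup>2\<^sup>p \<le> (A G)\<^sup>2\<close>.\<close>

lemma log_sobolev_hypercontractive:
  fixes g :: "'v::finite \<Rightarrow> real"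
  assumes A: "markov_kernel A" and \<mu>: "\<And>x. 0 \<le> \<mu> x" and \<nu>: "pos_prob (vmul \<mu> A)" and "0 \<le> l"
    and lsi: "\<And>f. l * entropy_L f (vmul \<mu> A) \<le> dirichlet (adjprod A \<mu>) (vmul \<mu> A) f"
    and g: "\<And>y. 0 \<le> g y" and "2 \<le> r * (1 + l)"
  shows "(\<Sum>x\<in>UNIV. \<mu> x * kapp A g x powr (r * (1 + l)))
    \<le> (\<Sum>y\<in>UNIV. vmul \<mu> A y * g y powr r) powr (1 + l)"
proof -
  define p where "p = r * (1 + l) / 2"
  define G where "G = (\<lambda>y. g y powr p)"
  have jensen: "kapp A g x powr (r * (1 + l)) \<le> (kapp A G x)\<^sup>2" for x
  proof -
    have "kapp A g x powr p \<le> kapp A G x"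
      unfolding kapp_def G_def using A g assms(7)
      by (intro powr_sum_le_sum_powr) (auto simp: markov_kernel_def p_def)
    then have "(kapp A g x powr p)\<^sup>2 \<le> (kapp A G x)\<^sup>2"
      by (intro power_mono) auto
    moreover have "(kapp A g x powr p)\<^sup>2 = kapp A g x powr (r * (1 + l))"
      by (simp add: power2_eq_square powr_add[symmetric] p_def)
    ultimately show ?thesis
      by simp
  qed
  have "(\<Sum>x\<in>UNIV. \<mu> x * kapp A g x powr (r * (1 + l))) \<le> l2norm_sq (kapp A G) \<mu>"
    unfolding l2norm_sq_def using jensen \<mu> by (intro sum_mono) (simp add: mult.commute mult_left_mono)
  also have "\<dots> \<le> l2norm_sq G (vmul \<mu> A) - l * entropy_L G (vmul \<mu> A)"
    using lsi[of G] dirichlet_adjprod_eq[OF A, of \<mu> G] \<nu> by (simp add: pos_prob_def)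
  also have "\<dots> \<le> (\<Sum>y\<in>UNIV. ((G y)\<^sup>2) powr (1 / (1 + l)) * vmul \<mu> A y) powr (1 + l)"
    by (rule l2norm_sq_minus_entropy_le[OF \<nu> \<open>0 \<le> l\<close>])
  also have "\<dots> = (\<Sum>y\<in>UNIV. g y powr r * vmul \<mu> A y) powr (1 + l)"
    using \<open>0 \<le> l\<close> by (simp add: G_def power2_eq_square powr_add[symmetric] p_def powr_powr)
  finally show ?thesis
    by (simp add: mult.commute)
qed

subsection \<open>The inhomogeneous chain\<close>

text \<open>The last kernel acts on \<open>g\<close> first and raises r to r * (1 + l). The
  remaining product is then handled at this larger exponent, so \<open>r\<close> must vary in the
  induction.\<close>

lemma hypercontractive_Kprod:
  fixes K :: "nat \<Rightarrow> 'v::finite \<Rightarrow> 'v \<Rightarrow> real"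
  assumes markov: "\<And>i. i \<ge> 1 \<Longrightarrow> markov_kernel (K i)" and \<mu>0: "\<And>x. 0 \<le> \<mu>0 x"
    and l: "\<And>i. 0 \<le> l i"
    and step: "\<And>i g r. (\<And>y. 0 \<le> g y) \<Longrightarrow> 2 \<le> r \<Longrightarrow>
      (\<Sum>x\<in>UNIV. mu_n \<mu>0 K i x * kapp (K (Suc i)) g x powr (r * (1 + l (Suc i))))
        \<le> (\<Sum>y\<in>UNIV. mu_n \<mu>0 K (Suc i) y * g y powr r) powr (1 + l (Suc i))"
    and "\<And>y. 0 \<le> g y" and "2 \<le> r"
  shows "(\<Sum>x\<in>UNIV. \<mu>0 x * kapp (Kprod K m) g x powr (r * (\<Prod>i=1..m. 1 + l i)))
    \<le> (\<Sum>y\<in>UNIV. mu_n \<mu>0 K m y * g y powr r) powr (\<Prod>i=1..m. 1 + l i)"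
  using assms(5,6)
proof (induction m arbitrary: g r)
  case 0
  then show ?case
    using \<mu>0 by (simp add: mu_n_0 kapp_idm sum_nonneg)
next
  case (Suc m)
  let ?Q = "\<Prod>i=1..m. 1 + l i" and ?A = "K (Suc m)" and ?r = "r * (1 + l (Suc m))"
  have Q: "0 \<le> ?Q"
    using l by (intro prod_nonneg) (simp add: add_nonneg_nonneg)
  have "r * 1 \<le> ?r"
    using l[of "Suc m"] Suc.prems by (intro mult_left_mono) auto
  then have "2 \<le> ?r"
    using Suc.prems(2) by linarith
  moreover have Ag: "0 \<le> kapp ?A g y" for y
    using markov Suc.prems by (intro kapp_nonneg) auto
  ultimately have "(\<Sum>x\<in>UNIV. \<mu>0 x * kapp (Kprod K m) (kapp ?A g) x powr (?r * ?Q))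
      \<le> (\<Sum>y\<in>UNIV. mu_n \<mu>0 K m y * kapp ?A g y powr ?r) powr ?Q"
    by (intro Suc.IH) auto
  also have "\<dots> \<le> ((\<Sum>y\<in>UNIV. mu_n \<mu>0 K (Suc m) y * g y powr r) powr (1 + l (Suc m))) powr ?Q"
  proof (intro powr_mono2 step Q sum_nonneg mult_nonneg_nonneg)
    show "0 \<le> mu_n \<mu>0 K m y" for y
      using \<mu>0 markov_kernel_Kprod[of K m] markov
      by (auto simp: mu_n_def vmul_def markov_kernel_def intro: sum_nonneg)
  qed (use Suc.prems in auto)
  finally show ?case
    by (simp add: kapp_mmul powr_powr prod.nat_ivl_Suc' mult_ac)
qed

section \<open>The squared distance to equilibrium\<close>

lemma Cauchy_Schwarz_weighted:
  assumes "\<And>x. 0 \<le> \<nu> x"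
  shows "(\<Sum>x\<in>UNIV. f x * g x * \<nu> x)\<^sup>2 \<le> l2norm_sq f \<nu> * l2norm_sq g \<nu>"
proof -
  have "(\<Sum>x\<in>UNIV. (f x * sqrt (\<nu> x)) * (g x * sqrt (\<nu> x)))\<^sup>2
      \<le> (\<Sum>x\<in>UNIV. (f x * sqrt (\<nu> x))\<^sup>2) * (\<Sum>x\<in>UNIV. (g x * sqrt (\<nu> x))\<^sup>2)"
    by (rule Cauchy_Schwarz_ineq_sum)
  moreover have "(f x * sqrt (\<nu> x)) * (g x * sqrt (\<nu> x)) = f x * g x * \<nu> x" for x
  proof -
    have "(f x * sqrt (\<nu> x)) * (g x * sqrt (\<nu> x)) = f x * g x * (sqrt (\<nu> x) * sqrt (\<nu> x))"
      by (simp only: mult_ac)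
    then show ?thesis
      using assms[of x] by simp
  qed
  ultimately show ?thesis
    using assms by (simp add: l2norm_sq_def power_mult_distrib)
qed

lemma d2_sq_eq_l2norm_sq:
  "d2_sq K \<mu>0 n x = l2norm_sq (\<lambda>y. Kprod K n x y / mu_n \<mu>0 K n y - 1) (mu_n \<mu>0 K n)"
  by (simp add: d2_sq_def l2norm_sq_def)

lemma mean_density_minus_1:
  assumes "markov_kernel (Kprod K n)" and "pos_prob (mu_n \<mu>0 K n)"
  shows "mean (\<lambda>y. Kprod K n x y / mu_n \<mu>0 K n y - 1) (mu_n \<mu>0 K n) = 0"
proof -
  have "(Kprod K n x y / mu_n \<mu>0 K n y - 1) * mu_n \<mu>0 K n y = Kprod K n x y - mu_n \<mu>0 K n y" for y
    using assms(2) by (simp add: pos_prob_def left_diff_distrib less_imp_neq[THEN not_sym])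
  then show ?thesis
    using assms by (simp add: mean_def sum_subtractf markov_kernel_def pos_prob_def)
qed

lemma d2_sq_eq_second_moment:
  assumes "markov_kernel (Kprod K n)" and "pos_prob (mu_n \<mu>0 K n)"
  shows "d2_sq K \<mu>0 n x = l2norm_sq (\<lambda>y. Kprod K n x y / mu_n \<mu>0 K n y) (mu_n \<mu>0 K n) - 1"
proof -
  have "mean (\<lambda>y. Kprod K n x y / mu_n \<mu>0 K n y) (mu_n \<mu>0 K n) = 1"
    using assms by (simp add: mean_def markov_kernel_def pos_prob_def less_imp_neq[THEN not_sym])
  then show ?thesis
    using assms(2) by (simp add: d2_sq_eq_l2norm_sq l2norm_sq_shift)
qed

text \<open>The density of \<open>K\<^sub>0\<^sub>,\<^sub>n\<^sub>+\<^sub>1(x, \<cdot>)\<close> is the image of that of \<open>K\<^sub>0\<^sub>,\<^sub>n(x, \<cdot>)\<close> under the adjoint of the kernel,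
  which contracts as the kernel itself does.\<close>

lemma d2_sq_Suc_le:
  assumes markov: "\<And>i. i \<ge> 1 \<Longrightarrow> markov_kernel (K i)" and pos: "\<And>n. pos_prob (mu_n \<mu>0 K n)"
    and "0 \<le> \<theta>"
    and contraction: "\<And>g. mean g (mu_n \<mu>0 K (Suc n)) = 0 \<Longrightarrow>
      l2norm_sq (kapp (K (Suc n)) g) (mu_n \<mu>0 K n) \<le> \<theta> * l2norm_sq g (mu_n \<mu>0 K (Suc n))"
  shows "d2_sq K \<mu>0 (Suc n) x \<le> \<theta> * d2_sq K \<mu>0 n x"
proof -
  let ?\<mu> = "mu_n \<mu>0 K n" and ?\<mu>' = "mu_n \<mu>0 K (Suc n)"
  define h where "h = (\<lambda>y. Kprod K n x y / ?\<mu> y - 1)"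
  define g where "g = (\<lambda>y. Kprod K (Suc n) x y / ?\<mu>' y - 1)"
  define \<delta> where "\<delta> = (\<lambda>y. Kprod K n x y - ?\<mu> y)"
  have nz: "mu_n \<mu>0 K m y \<noteq> 0" for m y
    using pos[of m] by (simp add: pos_prob_def less_imp_neq[THEN not_sym])
  have nonneg: "0 \<le> mu_n \<mu>0 K m y" for m y
    using pos[of m] by (simp add: pos_prob_def less_imp_le)
  have g: "d2_sq K \<mu>0 (Suc n) x = l2norm_sq g ?\<mu>'" and h: "d2_sq K \<mu>0 n x = l2norm_sq h ?\<mu>"
    unfolding g_def h_def by (rule d2_sq_eq_l2norm_sq)+
  have V0: "0 \<le> l2norm_sq g ?\<mu>'" and W0: "0 \<le> l2norm_sq h ?\<mu>"
    using nonneg by (auto intro: l2norm_sq_nonneg)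
  have "vmul \<delta> (K (Suc n)) y = Kprod K (Suc n) x y - ?\<mu>' y" for y
    by (simp add: \<delta>_def vmul_def mmul_def mu_n_Suc left_diff_distrib sum_subtractf del: One_nat_def)
  then have g_mult: "g y * ?\<mu>' y = vmul \<delta> (K (Suc n)) y" for y
    using nz[of "Suc n" y] by (simp add: g_def left_diff_distrib)
  then have "vmul \<delta> (K (Suc n)) y * g y = (g y)\<^sup>2 * ?\<mu>' y" for y
    by (simp add: power2_eq_square mult_ac flip: g_mult)
  \<comment> \<open>Duality: pairing the signed measure \<open>\<delta>\<close> after one step with
    \<open>g\<close> moves the kernel onto \<open>g\<close>. Cauchy-Schwarz and the contraction then
    bound the square of the norm by a multiple of the norm, and one factor cancels.\<close>
  then have "l2norm_sq g ?\<mu>' = (\<Sum>z\<in>UNIV. \<delta> z * kapp (K (Suc n)) g z)"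
    by (simp add: sum_kapp_eq_sum_vmul l2norm_sq_def)
  also have "\<dots> = (\<Sum>z\<in>UNIV. h z * kapp (K (Suc n)) g z * ?\<mu> z)"
    using nz[of n] by (intro sum.cong) (auto simp: \<delta>_def h_def field_simps)
  finally have "(l2norm_sq g ?\<mu>')\<^sup>2 \<le> l2norm_sq h ?\<mu> * l2norm_sq (kapp (K (Suc n)) g) ?\<mu>"
    using Cauchy_Schwarz_weighted[of ?\<mu> h "kapp (K (Suc n)) g"] nonneg by simp
  also have "\<dots> \<le> l2norm_sq h ?\<mu> * (\<theta> * l2norm_sq g ?\<mu>')"
    unfolding g_def using W0 markov_kernel_Kprod[of K "Suc n"] markov pos
    by (intro mult_left_mono contraction mean_density_minus_1) auto
  finally have "l2norm_sq g ?\<mu>' * l2norm_sq g ?\<mu>' \<le> (\<theta> * l2norm_sq h ?\<mu>) * l2norm_sq g ?\<mu>'"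
    by (simp add: power2_eq_square mult_ac)
  then show ?thesis
    unfolding g h using V0 W0 \<open>0 \<le> \<theta>\<close>
    by (cases "l2norm_sq g ?\<mu>' = 0") (auto simp: mult_le_cancel_right)
qed

lemma d2_sq_le_prod:
  assumes "\<And>i. i \<ge> 1 \<Longrightarrow> 0 \<le> \<theta> i" and "\<And>n. d2_sq K \<mu>0 (Suc n) x \<le> \<theta> (Suc n) * d2_sq K \<mu>0 n x"
    and "m \<le> n"
  shows "d2_sq K \<mu>0 n x \<le> d2_sq K \<mu>0 m x * (\<Prod>i\<in>{m + 1..n}. \<theta> i)"
  using assms(3)
proof (induction n rule: dec_induct)
  case base
  then show ?case
    by simp
next
  case (step n)
  have "d2_sq K \<mu>0 (Suc n) x \<le> \<theta> (Suc n) * (d2_sq K \<mu>0 m x * (\<Prod>i\<in>{m + 1..n}. \<theta> i))"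
    using assms(1)[of "Suc n"] by (intro order_trans[OF assms(2)] mult_left_mono step.IH) auto
  then show ?case
    using step.hyps by (simp add: prod.nat_ivl_Suc' mult_ac)
qed

text \<open>Hypercontractivity is tested on the density \<open>h\<close> itself: \<open>K\<^sub>0\<^sub>,\<^sub>m h (x) = \<parallel>h\<parallel>\<^sup>2\<close>, and the value at
  \<open>x\<close> is at most \<open>\<mu>\<^sub>0(x)\<^sup>-\<^sup>1\<^sup>/\<^sup>q\<close> times the \<open>\<ell>\<^sup>q(\<mu>\<^sub>0)\<close> norm, where \<open>q = 2 Q\<close>.\<close>

lemma density_second_moment_le:
  assumes Kp: "markov_kernel (Kprod K m)" and pos: "\<And>n. pos_prob (mu_n \<mu>0 K n)"
    and "0 < Q" and Q: "ln (\<mu>0 x powr (-1/2)) \<le> Q"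
    and hyper: "\<And>g. (\<And>y. 0 \<le> g y) \<Longrightarrow>
      (\<Sum>x\<in>UNIV. \<mu>0 x * kapp (Kprod K m) g x powr (2 * Q))
        \<le> (\<Sum>y\<in>UNIV. mu_n \<mu>0 K m y * g y powr 2) powr Q"
  shows "l2norm_sq (\<lambda>y. Kprod K m x y / mu_n \<mu>0 K m y) (mu_n \<mu>0 K m) \<le> exp 2"
proof -
  let ?\<mu> = "mu_n \<mu>0 K m"
  define h where "h = (\<lambda>y. Kprod K m x y / ?\<mu> y)"
  define N where "N = l2norm_sq h ?\<mu>"
  have \<mu>: "0 < ?\<mu> y" for y
    using pos[of m] by (simp add: pos_prob_def)
  have \<mu>0: "0 < \<mu>0 y" for y
    using pos[of 0] by (simp add: pos_prob_def mu_n_0)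
  have h: "0 \<le> h y" for y
    using Kp \<mu>[of y] by (simp add: h_def markov_kernel_def)
  have N: "N = d2_sq K \<mu>0 m x + 1"
    unfolding N_def h_def using d2_sq_eq_second_moment[OF Kp pos] by simp
  have "0 \<le> d2_sq K \<mu>0 m x"
    unfolding d2_sq_eq_l2norm_sq using \<mu> by (intro l2norm_sq_nonneg) (simp add: less_imp_le)
  then have "0 < N"
    using N by simp
  have "kapp (Kprod K m) h x = N"
    unfolding kapp_def N_def l2norm_sq_def using \<mu>
    by (intro sum.cong) (auto simp: h_def power2_eq_square less_imp_neq[THEN not_sym])
  then have "\<mu>0 x * N powr (2 * Q) \<le> (\<Sum>x\<in>UNIV. \<mu>0 x * kapp (Kprod K m) h x powr (2 * Q))"
    using \<mu>0 member_le_sum[of x UNIV "\<lambda>x. \<mu>0 x * kapp (Kprod K m) h x powr (2 * Q)"]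
    by (simp add: less_imp_le)
  also have "\<dots> \<le> (\<Sum>y\<in>UNIV. ?\<mu> y * h y powr 2) powr Q"
    using h by (rule hyper)
  also have "(\<Sum>y\<in>UNIV. ?\<mu> y * h y powr 2) = N"
    unfolding N_def l2norm_sq_def using h by (simp add: powr_numeral mult.commute)
  \<comment> \<open>Writing N powr (2 * Q) as a product of two equal factors lets one cancel against
    the right side.\<close>
  finally have "\<mu>0 x * N powr Q * N powr Q \<le> 1 * N powr Q"
    by (simp add: powr_add[symmetric] mult.assoc)
  then have "\<mu>0 x * N powr Q \<le> 1"
    using \<open>0 < N\<close> by (simp add: mult_le_cancel_right)
  then have "ln (\<mu>0 x * N powr Q) \<le> 0"
    using \<mu>0[of x] \<open>0 < N\<close> by simp
  then have "ln (\<mu>0 x) + Q * ln N \<le> 0"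
    using \<mu>0[of x] \<open>0 < N\<close> by (simp add: ln_mult ln_powr)
  moreover have "- ln (\<mu>0 x) \<le> 2 * Q"
    using Q \<mu>0[of x] by (simp add: ln_powr)
  \<comment> \<open>The constant exp 2 arises here: Q * ln N \<le> - ln (\<mu>0 x) \<le> 2 *
    Q.\<close>
  ultimately have "Q * ln N \<le> Q * 2"
    by simp
  then have "ln N \<le> 2"
    using \<open>0 < Q\<close> by simp
  then show ?thesis
    using \<open>0 < N\<close> unfolding N_def h_def by (metis exp_le_cancel_iff exp_ln)
qed

section \<open>Consequences of stability, the one-point space, and the combined bound\<close>

lemma c_stable_pos_prob:
  assumes "1 < c" and markov: "\<And>i. i \<ge> 1 \<Longrightarrow> markov_kernel (K i)" and \<mu>0: "pos_prob \<mu>0"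
    and "c_stable c K \<mu>0"
  shows "pos_prob (mu_n \<mu>0 K n)"
proof -
  have "0 < mu_n \<mu>0 K n x" for x
  proof -
    have "0 < 1 / c"
      using \<open>1 < c\<close> by simp
    also have "\<dots> \<le> mu_n \<mu>0 K n x / \<mu>0 x"
      using assms(4) by (simp add: c_stable_def)
    finally show ?thesis
      using \<mu>0 by (simp add: pos_prob_def zero_less_divide_iff not_less[symmetric] less_not_sym)
  qed
  moreover have "sum (mu_n \<mu>0 K n) UNIV = 1"
    unfolding mu_n_def using sum_vmul[OF markov_kernel_Kprod[OF markov]] \<mu>0 by (simp add: pos_prob_def)
  ultimately show ?thesis
    by (simp add: pos_prob_def)
qed

text \<open>Covers the one-point space, where the logarithmic Sobolev constant is an infimum over
  the empty set and the spectral argument has no two points to start from.\<close>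

lemma d2_sq_singleton:
  fixes x :: "'v::finite"
  assumes "markov_kernel (Kprod K n)" and "pos_prob (mu_n \<mu>0 K n)" and "\<And>y :: 'v. y = x"
  shows "d2_sq K \<mu>0 n x = 0"
proof -
  have UNIV: "UNIV = {x}"
    using assms(3) by auto
  have "sum f UNIV = f x" for f :: "'v \<Rightarrow> real"
    unfolding UNIV by simp
  then have "Kprod K n x x = 1" and "mu_n \<mu>0 K n x = 1"
    using assms(1,2) unfolding markov_kernel_def pos_prob_def by metis+
  then show ?thesis
    unfolding d2_sq_def UNIV by simp
qed

theorem theorem4p6:
  fixes c :: real and K :: "nat \<Rightarrow> 'v::finite \<Rightarrow> 'v \<Rightarrow> real"
    and \<mu>0 :: "'v \<Rightarrow> real" and x :: 'v and n :: nat
  assumes "c > 1"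
    and "\<And>i. i \<ge> 1 \<Longrightarrow> markov_kernel (K i)"
    and "\<And>i. i \<ge> 1 \<Longrightarrow> irreducible_kernel (K i)"
    and "pos_prob \<mu>0"
    and "c_stable c K \<mu>0"
    and "\<exists>t. mt_cond c K \<mu>0 x t"
    and "n \<ge> mtilde c K \<mu>0 x"
  shows "d2_sq K \<mu>0 n x \<le> exp 2 *
     (\<Prod>i\<in>{mtilde c K \<mu>0 x + 1..n}. 1 - c powr (-2) * (1 - (sigma1 (K i) \<mu>0)^2))"
proof -
  note markov = assms(2)
  define m where "m = mtilde c K \<mu>0 x"
  define \<theta> where "\<theta> = (\<lambda>i. 1 - c powr (-2) * (1 - (sigma1 (K i) \<mu>0)\<^sup>2))"
  have \<theta>: "0 \<le> \<theta> i" for i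
    unfolding \<theta>_def using \<open>c > 1\<close> by (rule contraction_factor_nonneg)
  have pos: "pos_prob (mu_n \<mu>0 K i)" for i
    using c_stable_pos_prob[OF \<open>c > 1\<close> markov assms(4,5)] .
  have Kp: "markov_kernel (Kprod K i)" for i
    using markov by (rule markov_kernel_Kprod)
  show ?thesis
  proof (cases "\<exists>w. w \<noteq> x")
    case False
    then show ?thesis
      using d2_sq_singleton[OF Kp pos, of x] \<theta> by (simp add: \<theta>_def prod_nonneg)
  next
    case True
    then obtain w where "x \<noteq> w"
      by metis
    have "0 < c"
      using \<open>c > 1\<close> by simp
    have \<mu>0: "0 < \<mu>0 y" "\<mu>0 y \<le> 1" for y
      using assms(4) member_le_sum[of y UNIV \<mu>0] by (auto simp: pos_prob_def less_imp_le)
    have up: "mu_n \<mu>0 K i y \<le> c * \<mu>0 y" and low: "\<mu>0 y \<le> c * mu_n \<mu>0 K i y" for i y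
    proof -
      have "1 / c \<le> mu_n \<mu>0 K i y / \<mu>0 y" and "mu_n \<mu>0 K i y / \<mu>0 y \<le> c"
        using assms(5) by (auto simp: c_stable_def)
      then show "mu_n \<mu>0 K i y \<le> c * \<mu>0 y" and "\<mu>0 y \<le> c * mu_n \<mu>0 K i y"
        using \<mu>0(1)[of y] \<open>0 < c\<close> by (simp_all add: field_simps)
    qed
    \<comment> \<open>Index 0 gets the value 0 because nothing is assumed about \<open>K 0\<close>;
      the product defining \<open>Q\<close> starts at 1.\<close>
    define l where "l = (\<lambda>i. if i = 0 then 0
      else c powr (-2) * logsob (adjprod (K i) \<mu>0) (vmul \<mu>0 (K i)))"
    have vpos: "pos_prob (vmul (mu_n \<mu>0 K i) (K (Suc i)))" for i
      using pos[of "Suc i"] by (simp add: mu_n_Suc)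
    have vpos0: "pos_prob (vmul \<mu>0 (K (Suc i)))" for i
      using comparison_pos_prob_vmul[OF markov assms(4) vpos \<open>0 < c\<close> up] by simp
    have l: "0 \<le> l i" for i
    proof (cases i)
      case (Suc j)
      have "markov_kernel (adjprod (K i) \<mu>0)"
        using Suc markov \<mu>0 vpos0[of j] by (intro markov_kernel_adjprod) (auto simp: pos_prob_def less_imp_le)
      then show ?thesis
        using logsob_nonneg[OF _ vpos0 \<open>x \<noteq> w\<close>] by (simp add: Suc l_def markov_kernel_def)
    qed (simp add: l_def)
    have lsi: "l (Suc i) * entropy_L f (vmul (mu_n \<mu>0 K i) (K (Suc i)))
        \<le> dirichlet (adjprod (K (Suc i)) (mu_n \<mu>0 K i)) (vmul (mu_n \<mu>0 K i) (K (Suc i))) f" for i f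
      using comparison_log_sobolev[OF markov assms(4) vpos \<open>0 < c\<close> up low \<open>x \<noteq> w\<close>] by (simp add: l_def)
    define Q where "Q = (\<Prod>i=1..m. 1 + l i)"
    have l_pos: "0 < 1 + l i" for i
      using l[of i] by linarith
    have Q1: "1 \<le> Q"
      unfolding Q_def using l by (intro prod_ge_1) auto
    have "ln (\<mu>0 x powr (-1/2)) \<le> Q"
    proof -
      have "mt_cond c K \<mu>0 x m"
        unfolding m_def mtilde_def using assms(6) by (rule LeastI_ex)
      then have "ln (ln (\<mu>0 x powr (-1/2))) \<le> (\<Sum>i=1..m. ln (1 + l i))"
        by (simp add: mt_cond_def l_def)
      also have "\<dots> = ln Q"
        unfolding Q_def using less_imp_neq[OF l_pos, THEN not_sym] by (subst ln_prod) auto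
      finally have "ln (ln (\<mu>0 x powr (-1/2))) \<le> ln Q" .
      \<comment> \<open>Removing the outer logarithm requires its argument to be positive; if ln
        (\<mu>0 x powr (-1/2)) \<le> 0, the claim follows from 1 \<le> Q instead.\<close>
      then show ?thesis
        using Q1 ln_le_cancel_iff[of "ln (\<mu>0 x powr (-1/2))" Q] by linarith
    qed
    moreover have "(\<Sum>y\<in>UNIV. \<mu>0 y * kapp (Kprod K m) g y powr (2 * Q))
        \<le> (\<Sum>y\<in>UNIV. mu_n \<mu>0 K m y * g y powr 2) powr Q" if "\<And>y. 0 \<le> g y" for g
      unfolding Q_def
    proof (rule hypercontractive_Kprod[OF markov _ l])
      fix i and r :: real and g :: "'v \<Rightarrow> real"
      assume g: "\<And>y. 0 \<le> g y" and r: "2 \<le> r"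
      have "r * 1 \<le> r * (1 + l (Suc i))"
        using r l[of "Suc i"] by (intro mult_left_mono) auto
      then have "2 \<le> r * (1 + l (Suc i))"
        using r by linarith
      then show "(\<Sum>y\<in>UNIV. mu_n \<mu>0 K i y * kapp (K (Suc i)) g y powr (r * (1 + l (Suc i))))
          \<le> (\<Sum>y\<in>UNIV. mu_n \<mu>0 K (Suc i) y * g y powr r) powr (1 + l (Suc i))"
        unfolding mu_n_Suc
      proof (intro log_sobolev_hypercontractive markov vpos l lsi g)
        show "0 \<le> mu_n \<mu>0 K i y" for y
          using pos[of i] by (simp add: pos_prob_def less_imp_le)
      qed auto
    qed (use that \<mu>0 in \<open>auto simp: less_imp_le\<close>)
    ultimately have "l2norm_sq (\<lambda>y. Kprod K m x y / mu_n \<mu>0 K m y) (mu_n \<mu>0 K m) \<le> exp 2"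
      using Q1 by (intro density_second_moment_le[OF Kp pos, of Q]) auto
    \<comment> \<open>The squared distance is the second moment minus 1; this 1 is given
      away.\<close>
    then have d2m: "d2_sq K \<mu>0 m x \<le> exp 2"
      using d2_sq_eq_second_moment[OF Kp pos, where n = m and x = x] by simp
    have "d2_sq K \<mu>0 (Suc i) x \<le> \<theta> (Suc i) * d2_sq K \<mu>0 i x" for i
    proof (rule d2_sq_Suc_le[OF markov pos \<theta>])
      fix g :: "'v \<Rightarrow> real"
      assume "mean g (mu_n \<mu>0 K (Suc i)) = 0"
      then show "l2norm_sq (kapp (K (Suc i)) g) (mu_n \<mu>0 K i) \<le> \<theta> (Suc i) * l2norm_sq g (mu_n \<mu>0 K (Suc i))"
        unfolding mu_n_Suc \<theta>_def
        by (intro comparison_kapp_contraction[OF markov assms(4) vpos \<open>0 < c\<close> up low \<open>x \<noteq> w\<close>]) auto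
    qed
    then have "d2_sq K \<mu>0 n x \<le> d2_sq K \<mu>0 m x * (\<Prod>i\<in>{m + 1..n}. \<theta> i)"
      using \<theta> assms(7) by (intro d2_sq_le_prod) (auto simp: m_def)
    also have "\<dots> \<le> exp 2 * (\<Prod>i\<in>{m + 1..n}. \<theta> i)"
      using d2m \<theta> by (intro mult_right_mono prod_nonneg) auto
    finally show ?thesis
      by (simp add: m_def \<theta>_def)
  qed
qed

end
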